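(* Let $n\ge 1$, let $F(x,y_0,y_1,\dots,y_n)$ be a function holomorphic near $0\in\mathbb{C}^{n+2}$, and let $\varphi=\sum_{k=1}^{\infty}c_kx^{\lambda_k}$ be a generalized power series with $\mathrm{Re}\,\lambda_1>0$. Suppose that one of the following holds. (A) For $\Delta=\delta$ or $\Delta=\sigma$, the series $\varphi$ formally satisfies the equation $F(x,y,\Delta y,\dots,\Delta^n y)=0$, and $$F'_{y_j}(x,\varphi,\Delta\varphi,\ldots,\Delta^n\varphi)=A_jx^{\nu}+o(x^\nu)\in\mathcal{G},\qquad j=0,1,\dots,n,$$ where $A_j\in\mathbb{C}$, the number $\nu\in\mathbb{C}$ is the same for all $j=0,1,\ldots,n$, and at least one of the $A_j$'s is nonzero. (B) The series $\varphi$ formally satisfies the equation $F(x,y,\mu y,\dots,\mu^n y)=0$, and $$F'_{y_0}(x,\varphi,\mu\varphi,\ldots,\mu^n\varphi)=A_0x^{\nu_0}+o(x^{\nu_0})\in\mathcal{G},\qquad A_0\ne0,$$ for some $\nu_0\in\mathbb{C}$. Then $\varphi\in\mathbb{C}[[x^\Gamma]]\subset\mathcal{G}$, where $\Gamma$ is a finitely generated additive semigroup whose generators are linearly independent over $\mathbb{Z}$ and have positive real parts.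
   Context: A generalized power series is a formal series $\varphi=\sum_{k=1}^{\infty}c_kx^{\lambda_k}$ with $c_k\in\mathbb{C}$ and pairwise distinct $\lambda_k\in\mathbb{C}$ such that $0<\mathrm{Re}\,\lambda_1\le\mathrm{Re}\,\lambda_2\le\dots$ and $\mathrm{Re}\,\lambda_k\to+\infty$ (coefficients may vanish, so finite sums are included). $\mathcal{G}$ denotes the ring of all such series, with a constant term also allowed. $F'_{y_j}$ is the partial derivative $\partial F/\partial y_j$. $o(x^\nu)\in\mathcal{G}$ denotes a generalized power series starting with a power exponent whose real part is strictly greater than $\mathrm{Re}\,\nu$. Operators: $\delta=x\frac{d}{dx}$, so $\delta x^\lambda=\lambda x^\lambda$; $\sigma:y(x)\mapsto y(qx)$ with $q\in\mathbb{C}$, $q\ne0,1$, and a fixed value of $\ln q$, so $\sigma x^\lambda=q^\lambda x^\lambda$ with $q^\lambda=e^{\lambda\ln q}$; $\mu:y(x)\mapsto y(x^\ell)$ with an integer $\ell\ge2$, so $\mu x^\lambda=x^{\ell\lambda}$. All are extended termwise to $\mathcal{G}$. Substituting series of positive-real-part exponents into the Taylor series of a function holomorphic near $0$ gives an element of $\mathcal{G}$; $\varphi$ formally satisfies the equation $F(x,y,\Delta y,\dots,\Delta^n y)=0$ if $F(x,\varphi,\Delta\varphi,\dots,\Delta^n\varphi)=0$ in $\mathcal{G}$. For a finitely generated additive semigroup $\Gamma\subset\mathbb{C}$ with generators $\rho_1,\dots,\rho_\tau$, $\mathbb{C}[[x^\Gamma]]\subset\mathcal{G}$ is the ring of generalized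 power series whose power exponents lie in $\Gamma$, i.e. are of the form $m_1\rho_1+\dots+m_\tau\rho_\tau$ with $m_i\in\mathbb{Z}_+=\{0,1,2,\dots\}$. *)

theory Defs
  imports "HOL-Complex_Analysis.Complex_Analysis"
begin

section \<open>The ring of generalized power series\<close>

text \<open>
  A series is represented by its coefficient function, sending an exponent to the coefficient
  of the corresponding power of \<open>x\<close>.  That only finitely many exponents with nonzero
  coefficient lie in any half-plane \<open>Re a \<le> r\<close> is what it means for them to be
  arranged in a (finite or infinite) sequence with non-decreasing real parts that, if infinite,
  tend to \<open>+\<infinity>\<close>.  The exponent \<open>0\<close> is the constant term.
\<close>

typedef gps = "{f :: complex \<Rightarrow> complex.
    (\<forall>a. f a \<noteq> 0 \<longrightarrow> a = 0 \<or> Re a > 0) \<and> (\<forall>r. finite {a. f a \<noteq> 0 \<and> Re a \<le> r})}"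
  morphisms gps_coeff Abs_gps
  by (rule exI[of _ "\<lambda>_. 0"]) simp

setup_lifting type_definition_gps

lemma gps_eqI: "(\<And>a. gps_coeff f a = gps_coeff g a) \<Longrightarrow> f = g"
  by (metis ext gps_coeff_inject)

lemma gps_coeff_nonzero_cases: "gps_coeff f a \<noteq> 0 \<Longrightarrow> a = 0 \<or> Re a > 0"
  by transfer blast

lemma gps_coeff_nonzero_Re: "gps_coeff f a \<noteq> 0 \<Longrightarrow> Re a \<ge> 0"
  using gps_coeff_nonzero_cases[of f a] by auto

lemma gps_finite_support: "finite {a. gps_coeff f a \<noteq> 0 \<and> Re a \<le> r}"
  by transfer blast

instantiation gps :: comm_ring_1
begin

lift_definition zero_gps :: gps is "\<lambda>_. 0"
  by simp

lift_definition one_gps :: gps is "\<lambda>a. if a = 0 then 1 else 0"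
proof (intro conjI allI impI)
  fix r :: real
  show "finite {a::complex. (if a = 0 then 1 else 0 :: complex) \<noteq> 0 \<and> Re a \<le> r}"
    by (rule finite_subset[of _ "{0}"]) (auto split: if_splits)
qed (auto split: if_splits)

lift_definition plus_gps :: "gps \<Rightarrow> gps \<Rightarrow> gps" is "\<lambda>f g a. f a + g a"
proof (intro conjI allI impI, goal_cases)
  case (1 f g a)
  then show ?case by (metis add.right_neutral)
next
  case (2 f g r)
  then have "finite ({a. f a \<noteq> 0 \<and> Re a \<le> r} \<union> {a. g a \<noteq> 0 \<and> Re a \<le> r})" by blast
  then show ?case by (rule finite_subset[rotated]) auto
qed

lift_definition uminus_gps :: "gps \<Rightarrow> gps" is "\<lambda>f a. - f a"
  by simp

definition minus_gps :: "gps \<Rightarrow> gps \<Rightarrow> gps" where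
  "minus_gps f g = f + - g"

text \<open>The index set of the sum is finite by lemma \<open>gps_mult_finite\<close> below.\<close>

lift_definition times_gps :: "gps \<Rightarrow> gps \<Rightarrow> gps" is
  "\<lambda>f g a. \<Sum>b | f b \<noteq> 0 \<and> g (a - b) \<noteq> 0. f b * g (a - b)"
proof (intro conjI allI impI, goal_cases)
  case (1 f g a)
  from 1(3) obtain b where "f b \<noteq> 0" "g (a - b) \<noteq> 0"
    by (rule sum.not_neutral_contains_not_neutral) auto
  with 1 have "b = 0 \<or> Re b > 0" "a - b = 0 \<or> Re (a - b) > 0" by blast+
  then show ?case by auto
next
  case (2 f g r)
  let ?A = "{a. f a \<noteq> 0 \<and> Re a \<le> r}" and ?B = "{a. g a \<noteq> 0 \<and> Re a \<le> r}"
  have fin: "finite ((\<lambda>(a, b). a + b) ` (?A \<times> ?B))" using 2 by blast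
  have nonneg: "Re a \<ge> 0" if "f a \<noteq> 0 \<or> g a \<noteq> 0" for a
  proof -
    have "a = 0 \<or> Re a > 0" using that 2 by blast
    then show ?thesis by auto
  qed
  have "a \<in> (\<lambda>(a, b). a + b) ` (?A \<times> ?B)"
    if a: "(\<Sum>b | f b \<noteq> 0 \<and> g (a - b) \<noteq> 0. f b * g (a - b)) \<noteq> 0" "Re a \<le> r" for a
  proof -
    obtain b where b: "f b \<noteq> 0" "g (a - b) \<noteq> 0"
      using a(1) by (rule sum.not_neutral_contains_not_neutral) auto
    then have "Re b \<ge> 0" "Re (a - b) \<ge> 0" using nonneg by blast+
    then have "b \<in> ?A" "a - b \<in> ?B" using b a(2) by auto
    then show ?thesis by (intro image_eqI[of _ _ "(b, a - b)"]) auto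
  qed
  then show ?case by (intro finite_subset[OF _ fin] subsetI) blast
qed

lemma gps_mult_finite: "finite {b. gps_coeff f b \<noteq> 0 \<and> gps_coeff g (a - b) \<noteq> 0}"
proof (rule finite_subset[OF _ gps_finite_support[of f "Re a"]], clarify)
  fix b assume "gps_coeff g (a - b) \<noteq> 0"
  then show "Re b \<le> Re a" using gps_coeff_nonzero_Re[of g "a - b"] by simp
qed

lemma gps_mult_nonzeroE:
  assumes "gps_coeff (f * g) a \<noteq> 0"
  obtains b where "gps_coeff f b \<noteq> 0" "gps_coeff g (a - b) \<noteq> 0"
  using assms unfolding times_gps.rep_eq
  by (rule sum.not_neutral_contains_not_neutral) auto

lemma gps_coeff_mult_superset:
  assumes "finite B" "{b. gps_coeff f b \<noteq> 0 \<and> Re b \<le> Re a} \<subseteq> B"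
  shows "gps_coeff (f * g) a = (\<Sum>b\<in>B. gps_coeff f b * gps_coeff g (a - b))"
  unfolding times_gps.rep_eq
proof (rule sum.mono_neutral_left[OF assms(1)])
  show "{b. gps_coeff f b \<noteq> 0 \<and> gps_coeff g (a - b) \<noteq> 0} \<subseteq> B"
  proof
    fix b assume "b \<in> {b. gps_coeff f b \<noteq> 0 \<and> gps_coeff g (a - b) \<noteq> 0}"
    then have "gps_coeff f b \<noteq> 0 \<and> Re b \<le> Re a"
      using gps_coeff_nonzero_Re[of g "a - b"] by auto
    then show "b \<in> B" using assms(2) by blast
  qed
qed auto

lemma gps_mult_comm: "f * g = g * (f :: gps)"
proof (rule gps_eqI)
  fix a
  show "gps_coeff (f * g) a = gps_coeff (g * f) a"
    unfolding times_gps.rep_eq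
    by (rule sum.reindex_bij_witness[of _ "\<lambda>b. a - b" "\<lambda>b. a - b"]) (auto simp: mult.commute)
qed

lemma gps_mult_assoc: "(f * g) * h = f * (g * (h :: gps))"
proof (rule gps_eqI)
  fix a
  let ?F = "{b. gps_coeff f b \<noteq> 0 \<and> Re b \<le> Re a}"
  let ?G = "{b. gps_coeff g b \<noteq> 0 \<and> Re b \<le> Re a}"
  define D where "D = (\<lambda>(b, c). b + c) ` (?F \<times> ?G)"
  have finF: "finite ?F" and finG: "finite ?G" by (rule gps_finite_support)+
  then have finD: "finite D" unfolding D_def by blast
  have D_sup: "{d. gps_coeff (f * g) d \<noteq> 0 \<and> Re d \<le> Re a} \<subseteq> D"
  proof
    fix d assume d: "d \<in> {d. gps_coeff (f * g) d \<noteq> 0 \<and> Re d \<le> Re a}"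
    then obtain b where b: "gps_coeff f b \<noteq> 0" "gps_coeff g (d - b) \<noteq> 0"
      by (auto elim: gps_mult_nonzeroE)
    then have "Re b \<ge> 0" "Re (d - b) \<ge> 0" by (auto dest: gps_coeff_nonzero_Re)
    with b d have "(b, d - b) \<in> ?F \<times> ?G" by auto
    then show "d \<in> D" unfolding D_def by (intro image_eqI[of _ _ "(b, d - b)"]) auto
  qed
  have fg: "gps_coeff (f * g) d = (\<Sum>b\<in>?F. gps_coeff f b * gps_coeff g (d - b))"
    if "Re d \<le> Re a" for d
    by (rule gps_coeff_mult_superset[OF finF]) (use that in auto)
  have gh: "gps_coeff (g * h) (a - b) = (\<Sum>c\<in>?G. gps_coeff g c * gps_coeff h (a - b - c))"
    if "b \<in> ?F" for b
    by (rule gps_coeff_mult_superset[OF finG]) (use that gps_coeff_nonzero_Re[of f b] in auto)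
  have "gps_coeff ((f * g) * h) a = (\<Sum>d\<in>D. gps_coeff (f * g) d * gps_coeff h (a - d))"
    by (rule gps_coeff_mult_superset[OF finD D_sup])
  also have "\<dots> = (\<Sum>d\<in>D. (\<Sum>b\<in>?F. gps_coeff f b * gps_coeff g (d - b)) * gps_coeff h (a - d))"
  proof (rule sum.cong[OF refl])
    fix d
    show "gps_coeff (f * g) d * gps_coeff h (a - d) =
        (\<Sum>b\<in>?F. gps_coeff f b * gps_coeff g (d - b)) * gps_coeff h (a - d)"
    proof (cases "Re d \<le> Re a")
      case False
      then have "gps_coeff h (a - d) = 0" using gps_coeff_nonzero_Re[of h "a - d"] by auto
      then show ?thesis by simp
    qed (simp add: fg)
  qed
  also have "\<dots> = (\<Sum>b\<in>?F. gps_coeff f b * (\<Sum>d\<in>D. gps_coeff g (d - b) * gps_coeff h (a - d)))"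
    by (simp add: sum_distrib_left sum_distrib_right mult.assoc)
      (rule sum.swap)
  also have "\<dots> = (\<Sum>b\<in>?F. gps_coeff f b * gps_coeff (g * h) (a - b))"
  proof (rule sum.cong[OF refl])
    fix b assume b: "b \<in> ?F"
    have "(\<Sum>d\<in>D. gps_coeff g (d - b) * gps_coeff h (a - d)) =
        (\<Sum>d\<in>(\<lambda>c. b + c) ` ?G. gps_coeff g (d - b) * gps_coeff h (a - d))"
    proof (rule sum.mono_neutral_right[OF finD])
      show "(\<lambda>c. b + c) ` ?G \<subseteq> D"
        unfolding D_def using b by force
      show "\<forall>d\<in>D - (\<lambda>c. b + c) ` ?G. gps_coeff g (d - b) * gps_coeff h (a - d) = 0"
      proof (rule ballI, rule ccontr)
        fix d assume d: "d \<in> D - (\<lambda>c. b + c) ` ?G"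
          and "gps_coeff g (d - b) * gps_coeff h (a - d) \<noteq> 0"
        then have nz: "gps_coeff g (d - b) \<noteq> 0" "gps_coeff h (a - d) \<noteq> 0" by auto
        have "Re (d - b) \<le> Re a"
          using gps_coeff_nonzero_Re[OF nz(2)] gps_coeff_nonzero_Re[of f b] b by auto
        with nz have "d - b \<in> ?G" by auto
        then have "d \<in> (\<lambda>c. b + c) ` ?G" by (intro image_eqI[of _ _ "d - b"]) auto
        with d show False by blast
      qed
    qed
    also have "\<dots> = (\<Sum>c\<in>?G. gps_coeff g c * gps_coeff h (a - b - c))"
      by (subst sum.reindex) (auto simp: inj_on_def diff_diff_eq)
    finally show "gps_coeff f b * (\<Sum>d\<in>D. gps_coeff g (d - b) * gps_coeff h (a - d)) =
        gps_coeff f b * gps_coeff (g * h) (a - b)" using gh[OF b] by simp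
  qed
  also have "\<dots> = gps_coeff (f * (g * h)) a"
    by (rule gps_coeff_mult_superset[OF finF subset_refl, symmetric])
  finally show "gps_coeff ((f * g) * h) a = gps_coeff (f * (g * h)) a" .
qed

instance
proof
  fix f g h :: gps
  show "f * g * h = f * (g * h)" by (rule gps_mult_assoc)
  show "f * g = g * f" by (rule gps_mult_comm)
  show "f + g + h = f + (g + h)" by (rule gps_eqI) (simp add: plus_gps.rep_eq)
  show "f + g = g + f" by (rule gps_eqI) (simp add: plus_gps.rep_eq)
  show "0 + f = f" by (rule gps_eqI) (simp add: plus_gps.rep_eq zero_gps.rep_eq)
  show "- f + f = 0"
    by (rule gps_eqI) (simp add: plus_gps.rep_eq zero_gps.rep_eq uminus_gps.rep_eq)
  show "f - g = f + - g" by (simp add: minus_gps_def)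
  show "(0 :: gps) \<noteq> 1"
    by (metis one_gps.rep_eq zero_gps.rep_eq zero_neq_one)
  show "1 * f = f"
  proof (rule gps_eqI)
    fix a
    have "{b. gps_coeff 1 b \<noteq> 0 \<and> Re b \<le> Re a} \<subseteq> {0}"
      by (auto simp: one_gps.rep_eq split: if_splits)
    from gps_coeff_mult_superset[OF _ this, of f]
    show "gps_coeff (1 * f) a = gps_coeff f a" by (simp add: one_gps.rep_eq)
  qed
  show "(f + g) * h = f * h + g * h"
  proof (rule gps_eqI)
    fix a
    let ?B = "{b. gps_coeff f b \<noteq> 0 \<and> Re b \<le> Re a} \<union> {b. gps_coeff g b \<noteq> 0 \<and> Re b \<le> Re a}"
    have B: "finite ?B" by (simp add: gps_finite_support)
    have "gps_coeff (k * h) a = (\<Sum>b\<in>?B. gps_coeff k b * gps_coeff h (a - b))"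
      if "k \<in> {f, g, f + g}" for k
      by (rule gps_coeff_mult_superset[OF B]) (use that in \<open>auto simp: plus_gps.rep_eq\<close>)
    then show "gps_coeff ((f + g) * h) a = gps_coeff (f * h + g * h) a"
      by (simp add: plus_gps.rep_eq distrib_right sum.distrib)
  qed
qed

end

lift_definition gps_X :: gps is "\<lambda>a. if a = 1 then 1 else 0"
proof (intro conjI allI impI)
  fix r :: real
  show "finite {a::complex. (if a = 1 then 1 else 0 :: complex) \<noteq> 0 \<and> Re a \<le> r}"
    by (rule finite_subset[of _ "{1}"]) (auto split: if_splits)
qed (auto split: if_splits)

definition gps_expansion :: "gps \<Rightarrow> (nat \<Rightarrow> complex) \<Rightarrow> (nat \<Rightarrow> complex) \<Rightarrow> bool" where
  "gps_expansion f c lam \<longleftrightarrow>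
     inj lam \<and> mono (\<lambda>k. Re (lam k)) \<and> filterlim (\<lambda>k. Re (lam k)) at_top sequentially \<and>
     (\<forall>k. gps_coeff f (lam k) = c k) \<and> (\<forall>a. a \<notin> range lam \<longrightarrow> gps_coeff f a = 0)"

text \<open>Every sequence of exponents and coefficients as in the definition of a generalized power
  series is the expansion of a (unique) element of \<open>gps\<close>.\<close>

lemma gps_expansion_exists:
  assumes "inj lam" "mono (\<lambda>k. Re (lam k))" "filterlim (\<lambda>k. Re (lam k)) at_top sequentially"
    and "Re (lam 0) > 0"
  shows "\<exists>!f. gps_expansion f c lam"
proof -
  define g where "g a = (if a \<in> range lam then c (inv lam a) else 0)" for a
  have pos: "Re (lam k) > 0" for k
    using monoD[OF assms(2), of 0 k] assms(4) by simp
  have "finite {a. g a \<noteq> 0 \<and> Re a \<le> r}" for r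
  proof -
    obtain K where K: "\<And>k. k \<ge> K \<Longrightarrow> Re (lam k) > r"
      using assms(3) unfolding filterlim_at_top_dense eventually_sequentially by meson
    have "{a. g a \<noteq> 0 \<and> Re a \<le> r} \<subseteq> lam ` {..<K}"
      unfolding g_def using K by (force split: if_splits simp: not_le[symmetric])
    then show ?thesis by (rule finite_subset) simp
  qed
  then have g: "gps_coeff (Abs_gps g) = g"
    using pos by (intro Abs_gps_inverse) (auto simp: g_def split: if_splits)
  show ?thesis
  proof
    show "gps_expansion (Abs_gps g) c lam"
      unfolding gps_expansion_def g using assms by (simp add: g_def)
    fix f assume f: "gps_expansion f c lam"
    show "f = Abs_gps g"
      by (rule gps_eqI) (use f assms(1) in \<open>auto simp: gps_expansion_def g g_def\<close>)
  qed
qed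

text \<open>\<open>gps_leading H A \<nu>\<close> is the relation \<open>H = A x\<^sup>\<nu> + o(x\<^sup>\<nu>)\<close> in the ring.  It is stated on
  coefficients because \<open>x\<^sup>\<nu>\<close> itself is an element of the ring only for
  \<open>\<nu> = 0\<close> or \<open>Re \<nu> > 0\<close>; for other \<open>\<nu>\<close> it forces \<open>A = 0\<close>.\<close>

definition gps_small_o :: "complex \<Rightarrow> gps \<Rightarrow> bool" where
  "gps_small_o \<nu> R \<longleftrightarrow> (\<forall>a. gps_coeff R a \<noteq> 0 \<longrightarrow> Re a > Re \<nu>)"

definition gps_leading :: "gps \<Rightarrow> complex \<Rightarrow> complex \<Rightarrow> bool" where
  "gps_leading H A \<nu> \<longleftrightarrow>
     (\<exists>R. gps_small_o \<nu> R \<and> (\<forall>a. gps_coeff H a = (if a = \<nu> then A else 0) + gps_coeff R a))"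


section \<open>The operators\<close>

lift_definition gps_delta :: "gps \<Rightarrow> gps" is "\<lambda>f a. a * f a"
proof (intro conjI allI impI, goal_cases)
  case (2 f r)
  then have "finite {a. f a \<noteq> 0 \<and> Re a \<le> r}" by blast
  then show ?case by (rule finite_subset[rotated]) auto
qed auto

text \<open>The argument of \<open>gps_sigma\<close> is the chosen value of \<open>ln q\<close>.\<close>

lift_definition gps_sigma :: "complex \<Rightarrow> gps \<Rightarrow> gps" is "\<lambda>lnq f a. exp (a * lnq) * f a"
  by simp

text \<open>\<open>gps_mu l\<close> substitutes \<open>x\<^sup>l\<close> for \<open>x\<close>; it is only meaningful for \<open>l \<ge> 1\<close> and set to
  \<open>0\<close> for \<open>l = 0\<close>.\<close>

lift_definition gps_mu :: "nat \<Rightarrow> gps \<Rightarrow> gps" is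
  "\<lambda>l f a. if l = 0 then 0 else f (a / of_nat l)"
proof (intro conjI allI impI, goal_cases)
  case (1 l f a)
  then have "l \<noteq> 0" "a / of_nat l = 0 \<or> Re (a / of_nat l) > 0" by (auto split: if_splits)
  then show ?case by (auto simp: zero_less_divide_iff)
next
  case (2 l f r)
  show ?case
  proof (cases "l = 0")
    case False
    have sub: "{a. f (a / of_nat l) \<noteq> 0 \<and> Re a \<le> r} \<subseteq>
        (\<lambda>b. of_nat l * b) ` {b. f b \<noteq> 0 \<and> Re b \<le> r / real l}"
    proof
      fix a assume "a \<in> {a. f (a / of_nat l) \<noteq> 0 \<and> Re a \<le> r}"
      then have "a / of_nat l \<in> {b. f b \<noteq> 0 \<and> Re b \<le> r / real l}"
        by (auto intro: divide_right_mono)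
      then show "a \<in> (\<lambda>b. of_nat l * b) ` {b. f b \<noteq> 0 \<and> Re b \<le> r / real l}"
        using False by (intro image_eqI[of _ _ "a / of_nat l"]) auto
    qed
    have "finite {b. f b \<noteq> 0 \<and> Re b \<le> r / real l}" using 2 by blast
    then have "finite {a. f (a / of_nat l) \<noteq> 0 \<and> Re a \<le> r}"
      by (rule finite_subset[OF sub finite_imageI])
    then show ?thesis using False by simp
  qed simp
qed


section \<open>Holomorphic functions of several variables and substitution\<close>

text \<open>
  A point of \<open>\<complex>\<^sup>N\<close> is a function \<open>z :: nat \<Rightarrow> complex\<close> that vanishes outside
  \<open>{..<N}\<close>.  Holomorphy near \<open>0\<close> means: continuous, and holomorphic in each variable
  separately, on some polydisc around \<open>0\<close>.
\<close>

definition polydisc :: "nat \<Rightarrow> real \<Rightarrow> (nat \<Rightarrow> complex) set" where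
  "polydisc N r = {z. (\<forall>i<N. norm (z i) < r) \<and> (\<forall>i\<ge>N. z i = 0)}"

definition holomorphic_near_0 :: "nat \<Rightarrow> ((nat \<Rightarrow> complex) \<Rightarrow> complex) \<Rightarrow> bool" where
  "holomorphic_near_0 N F \<longleftrightarrow> (\<exists>r>0. continuous_on (polydisc N r) F \<and>
     (\<forall>z\<in>polydisc N r. \<forall>i<N. (\<lambda>t. F (z(i := t))) holomorphic_on ball 0 r))"

definition partial_deriv ::
    "nat \<Rightarrow> ((nat \<Rightarrow> complex) \<Rightarrow> complex) \<Rightarrow> (nat \<Rightarrow> complex) \<Rightarrow> complex" where
  "partial_deriv i F z = deriv (\<lambda>t. F (z(i := t))) (z i)"

definition multi_indices :: "nat \<Rightarrow> (nat \<Rightarrow> nat) set" where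
  "multi_indices N = {\<alpha>. \<forall>i\<ge>N. \<alpha> i = 0}"

definition taylor_coeff :: "nat \<Rightarrow> ((nat \<Rightarrow> complex) \<Rightarrow> complex) \<Rightarrow> (nat \<Rightarrow> nat) \<Rightarrow> complex" where
  "taylor_coeff N F \<alpha> =
     foldr (\<lambda>i. partial_deriv i ^^ \<alpha> i) [0..<N] F (\<lambda>_. 0) / (\<Prod>i<N. fact (\<alpha> i))"

text \<open>
  \<open>gps_subst N F G\<close> is the result of substituting \<open>G 0, \<dots>, G (N - 1)\<close> into the Taylor series of
  \<open>F\<close> at \<open>0\<close>.  It is meaningful when no \<open>G i\<close> has a constant term: then only finitely many
  multi-indices contribute to each coefficient, and the coefficients do define an element of
  the ring (lemmas \<open>gps_subst_finite\<close> and \<open>gps_coeff_subst\<close>).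
\<close>

definition gps_subst :: "nat \<Rightarrow> ((nat \<Rightarrow> complex) \<Rightarrow> complex) \<Rightarrow> (nat \<Rightarrow> gps) \<Rightarrow> gps" where
  "gps_subst N F G = Abs_gps (\<lambda>a.
     \<Sum>\<alpha> | \<alpha> \<in> multi_indices N \<and> gps_coeff (\<Prod>i<N. G i ^ \<alpha> i) a \<noteq> 0.
       taylor_coeff N F \<alpha> * gps_coeff (\<Prod>i<N. G i ^ \<alpha> i) a)"

lemma gps_mult_lower_bound:
  assumes "\<And>a. gps_coeff f a \<noteq> 0 \<Longrightarrow> Re a \<ge> s" "\<And>a. gps_coeff g a \<noteq> 0 \<Longrightarrow> Re a \<ge> t"
    and "gps_coeff (f * g) a \<noteq> 0"
  shows "Re a \<ge> s + t"
proof -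
  obtain b where b: "gps_coeff f b \<noteq> 0" "gps_coeff g (a - b) \<noteq> 0"
    using assms(3) by (rule gps_mult_nonzeroE)
  then show ?thesis using assms(1)[OF b(1)] assms(2)[OF b(2)] by simp
qed

lemma gps_power_lower_bound:
  assumes "\<And>a. gps_coeff f a \<noteq> 0 \<Longrightarrow> Re a \<ge> s"
  shows "gps_coeff (f ^ k) a \<noteq> 0 \<Longrightarrow> Re a \<ge> real k * s"
proof (induction k arbitrary: a)
  case 0
  then show ?case by (auto simp: one_gps.rep_eq split: if_splits)
next
  case (Suc k)
  have "gps_coeff (f * f ^ k) a \<noteq> 0" using Suc.prems by simp
  then have "Re a \<ge> s + real k * s"
    by (rule gps_mult_lower_bound[where s = s and t = "real k * s", rotated 2])
      (fact assms, fact Suc.IH)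
  then show ?case by (simp add: distrib_right)
qed

lemma gps_prod_lower_bound:
  fixes G :: "nat \<Rightarrow> gps"
  assumes "\<And>i a. i < N \<Longrightarrow> gps_coeff (G i) a \<noteq> 0 \<Longrightarrow> Re a \<ge> s i"
  shows "gps_coeff (\<Prod>i<N. G i) a \<noteq> 0 \<Longrightarrow> Re a \<ge> (\<Sum>i<N. s i)"
  using assms
proof (induction N arbitrary: a)
  case 0
  then show ?case by (auto simp: one_gps.rep_eq split: if_splits)
next
  case (Suc N)
  have "gps_coeff ((\<Prod>i<N. G i) * G N) a \<noteq> 0" using Suc.prems(1) by simp
  then have "Re a \<ge> (\<Sum>i<N. s i) + s N"
  proof (rule gps_mult_lower_bound[where s = "\<Sum>i<N. s i" and t = "s N", rotated 2])
    show "Re b \<ge> (\<Sum>i<N. s i)" if "gps_coeff (\<Prod>i<N. G i) b \<noteq> 0" for b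
      by (rule Suc.IH[OF that]) (simp add: Suc.prems(2))
    show "Re b \<ge> s N" if "gps_coeff (G N) b \<noteq> 0" for b
      using Suc.prems(2)[OF _ that] by simp
  qed
  then show ?case by simp
qed

lemma gps_subst_finite_below:
  assumes "\<And>i. i < N \<Longrightarrow> gps_coeff (G i) 0 = 0"
  shows "finite {\<alpha> \<in> multi_indices N. \<exists>a. gps_coeff (\<Prod>i<N. G i ^ \<alpha> i) a \<noteq> 0 \<and> Re a \<le> r}"
proof -
  define S where "S = (\<Union>i<N. {a. gps_coeff (G i) a \<noteq> 0 \<and> Re a \<le> 1})"
  define m where "m = Min (insert 1 (Re ` S))"
  have finS: "finite S" unfolding S_def by (simp add: gps_finite_support)
  have "Re a > 0" if "a \<in> S" for a
  proof -
    from that obtain i where "i < N" "gps_coeff (G i) a \<noteq> 0" unfolding S_def by blast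
    with assms[of i] gps_coeff_nonzero_cases[of "G i" a] show ?thesis by auto
  qed
  then have m: "m > 0" unfolding m_def using finS by (subst Min_gr_iff) auto
  have low: "Re a \<ge> m" if "i < N" "gps_coeff (G i) a \<noteq> 0" for i a
  proof (cases "Re a \<le> 1")
    case True
    with that have "a \<in> S" unfolding S_def by blast
    then show ?thesis unfolding m_def using finS by (intro Min_le) auto
  next
    case False
    have "m \<le> 1" unfolding m_def using finS by (intro Min_le) auto
    with False show ?thesis by simp
  qed
  define K where "K = nat \<lceil>r / m\<rceil>"
  have "{\<alpha> \<in> multi_indices N. \<exists>a. gps_coeff (\<Prod>i<N. G i ^ \<alpha> i) a \<noteq> 0 \<and> Re a \<le> r}
      \<subseteq> {\<alpha>. \<forall>i. (i \<in> {..<N} \<longrightarrow> \<alpha> i \<in> {..K}) \<and> (i \<notin> {..<N} \<longrightarrow> \<alpha> i = 0)}"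
  proof
    fix \<alpha> assume *: "\<alpha> \<in> {\<alpha> \<in> multi_indices N.
        \<exists>a. gps_coeff (\<Prod>i<N. G i ^ \<alpha> i) a \<noteq> 0 \<and> Re a \<le> r}"
    then obtain a where a: "gps_coeff (\<Prod>i<N. G i ^ \<alpha> i) a \<noteq> 0" "Re a \<le> r" by blast
    have "\<alpha> i \<le> K" if i: "i < N" for i
    proof -
      have "real (\<alpha> i) * m \<le> (\<Sum>i<N. real (\<alpha> i) * m)"
        by (rule member_le_sum) (use i m in auto)
      also have "\<dots> \<le> Re a"
      proof (rule gps_prod_lower_bound[OF _ a(1)])
        fix i b assume "i < N" and b: "gps_coeff (G i ^ \<alpha> i) b \<noteq> 0"
        then have "gps_coeff (G i) c \<noteq> 0 \<Longrightarrow> m \<le> Re c" for c by (intro low)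
        then show "real (\<alpha> i) * m \<le> Re b" by (rule gps_power_lower_bound[OF _ b])
      qed
      also have "\<dots> \<le> r" by (rule a(2))
      finally have "real (\<alpha> i) \<le> r / m" using m by (simp add: pos_le_divide_eq)
      also have "\<dots> \<le> real K" unfolding K_def by (rule real_nat_ceiling_ge)
      finally show ?thesis by simp
    qed
    moreover have "\<alpha> i = 0" if "i \<ge> N" for i
      using * that by (simp add: multi_indices_def)
    ultimately show "\<alpha> \<in> {\<alpha>. \<forall>i. (i \<in> {..<N} \<longrightarrow> \<alpha> i \<in> {..K}) \<and> (i \<notin> {..<N} \<longrightarrow> \<alpha> i = 0)}"
      by simp
  qed
  moreover have "finite \<dots>" by (rule finite_set_of_finite_funs) auto
  ultimately show ?thesis by (rule finite_subset)
qed

lemma gps_subst_finite: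
  assumes "\<And>i. i < N \<Longrightarrow> gps_coeff (G i) 0 = 0"
  shows "finite {\<alpha>. \<alpha> \<in> multi_indices N \<and> gps_coeff (\<Prod>i<N. G i ^ \<alpha> i) a \<noteq> 0}"
  by (rule finite_subset[OF _ gps_subst_finite_below[OF assms, where r = "Re a"]]) auto

lemma gps_coeff_subst:
  assumes "\<And>i. i < N \<Longrightarrow> gps_coeff (G i) 0 = 0"
  shows "gps_coeff (gps_subst N F G) a =
     (\<Sum>\<alpha> | \<alpha> \<in> multi_indices N \<and> gps_coeff (\<Prod>i<N. G i ^ \<alpha> i) a \<noteq> 0.
       taylor_coeff N F \<alpha> * gps_coeff (\<Prod>i<N. G i ^ \<alpha> i) a)"
proof -
  let ?M = "\<lambda>\<alpha>. \<Prod>i<N. G i ^ \<alpha> i"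
  let ?f = "\<lambda>a. \<Sum>\<alpha> | \<alpha> \<in> multi_indices N \<and> gps_coeff (?M \<alpha>) a \<noteq> 0.
       taylor_coeff N F \<alpha> * gps_coeff (?M \<alpha>) a"
  have ex: "\<exists>\<alpha>\<in>multi_indices N. gps_coeff (?M \<alpha>) a \<noteq> 0" if "?f a \<noteq> 0" for a
    using that by (rule sum.not_neutral_contains_not_neutral) auto
  have "finite {a. ?f a \<noteq> 0 \<and> Re a \<le> r}" for r
  proof -
    let ?A = "{\<alpha> \<in> multi_indices N. \<exists>a. gps_coeff (?M \<alpha>) a \<noteq> 0 \<and> Re a \<le> r}"
    have "{a. ?f a \<noteq> 0 \<and> Re a \<le> r} \<subseteq> (\<Union>\<alpha>\<in>?A. {a. gps_coeff (?M \<alpha>) a \<noteq> 0 \<and> Re a \<le> r})"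
      using ex by fast
    moreover have "finite \<dots>"
      by (intro finite_UN_I gps_subst_finite_below[OF assms] gps_finite_support)
    ultimately show ?thesis by (rule finite_subset)
  qed
  moreover have "a = 0 \<or> Re a > 0" if "?f a \<noteq> 0" for a
    using ex[OF that] gps_coeff_nonzero_cases by blast
  ultimately have "gps_coeff (Abs_gps ?f) = ?f" by (intro Abs_gps_inverse) simp
  then show ?thesis unfolding gps_subst_def by simp
qed

text \<open>Variable \<open>0\<close> stands for \<open>x\<close>, and variable \<open>Suc j\<close> for \<open>y\<^sub>j\<close>.\<close>

definition gps_args :: "(gps \<Rightarrow> gps) \<Rightarrow> gps \<Rightarrow> nat \<Rightarrow> gps" where
  "gps_args \<Delta> f i = (case i of 0 \<Rightarrow> gps_X | Suc j \<Rightarrow> (\<Delta> ^^ j) f)"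

definition eval_along ::
    "nat \<Rightarrow> ((nat \<Rightarrow> complex) \<Rightarrow> complex) \<Rightarrow> (gps \<Rightarrow> gps) \<Rightarrow> gps \<Rightarrow> gps" where
  "eval_along n F \<Delta> f = gps_subst (n + 2) F (gps_args \<Delta> f)"

definition formal_solution ::
    "nat \<Rightarrow> ((nat \<Rightarrow> complex) \<Rightarrow> complex) \<Rightarrow> (gps \<Rightarrow> gps) \<Rightarrow> gps \<Rightarrow> bool" where
  "formal_solution n F \<Delta> f \<longleftrightarrow> eval_along n F \<Delta> f = 0"


section \<open>Finitely generated semigroups of exponents\<close>

definition semigroup_generated :: "complex set \<Rightarrow> complex set" where
  "semigroup_generated P = {(\<Sum>\<rho>\<in>P. of_nat (m \<rho>) * \<rho>) | m :: complex \<Rightarrow> nat. True}"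

definition gps_exponents_in :: "complex set \<Rightarrow> gps set" where
  "gps_exponents_in \<Gamma> = {f. \<forall>a. gps_coeff f a \<noteq> 0 \<longrightarrow> a \<in> \<Gamma>}"

abbreviation independent_over_int :: "complex set \<Rightarrow> bool" where
  "independent_over_int P \<equiv> module.independent (\<lambda>k::int. (*) (of_int k)) P"

lemma module_int_complex: "module (\<lambda>k::int. (*) (of_int k :: complex))"
  by standard (simp_all add: algebra_simps)

end

theory Submission
  imports Defs
begin

text \<open>
  Let \<open>T\<close> be the set of exponents of \<open>\<phi>\<close> with real part greater than \<open>Re \<nu>\<close> (in the case of
  \<open>\<mu>\<close>, \<open>\<nu> = \<nu>\<^sub>0\<close>) and let \<open>P\<close> consist of \<open>1\<close> and the finitely many other exponents.  Write
  \<open>\<psi>\<close> for the part of \<open>\<phi>\<close> with exponents in \<open>T\<close>.  Expanding \<open>F\<close> along \<open>\<phi> - \<psi>\<close> around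
  \<open>\<phi>\<close> to first order (\<open>gps_subst_first_order\<close>) gives
  \<open>F(\<phi> - \<psi>) = - (\<Sum>j\<le>n. F\<^sub>j(\<phi>) \<cdot> \<Delta>\<^sup>j \<psi>) + R\<close>, where \<open>F\<^sub>j\<close> is the partial derivative with
  respect to \<open>y\<^sub>j\<close>.  The left-hand side only has exponents in the semigroup generated by \<open>P\<close>, and
  those of \<open>R\<close> contain at least two summands from \<open>T\<close>.  For \<open>\<kappa> \<in> T\<close> compare the coefficients
  at \<open>\<kappa> + \<nu>\<close>.  With \<open>m(\<kappa>) = \<kappa>\<close> or \<open>m(\<kappa>) = q\<^sup>\<kappa>\<close>, the leading terms of the \<open>F\<^sub>j(\<phi>)\<close> contribute
  \<open>(\<Sum>j\<le>n. A\<^sub>j m(\<kappa>)\<^sup>j)\<close> times the coefficient of \<open>\<phi>\<close> at \<open>\<kappa>\<close>.  Hence either this sum vanishes,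
  or \<open>\<kappa> + \<nu>\<close> also arises in another way: it lies in the semigroup generated by \<open>P\<close>; or it is
  \<open>s + t\<close> with \<open>t \<in> T\<close> and \<open>s\<close> in that semigroup, \<open>Re s > Re \<nu>\<close>; or it is a sum with at
  least two summands from \<open>T\<close>.  For \<open>\<mu>\<close> the terms with \<open>j \<ge> 1\<close> are all of the last kind,
  because \<open>l\<^sup>j t\<close> is a sum of at least two copies of \<open>t\<close>, and the factor in front of the
  coefficient of \<open>\<phi>\<close> is \<open>A\<^sub>0\<close>, which is not zero.

  In each of the three cases \<open>\<kappa>\<close> is determined by exponents with smaller real part.  Induction on
  the real part then shows that all differences \<open>\<kappa> - \<nu>\<close> lie in one finitely generated semigroup
  (\<open>pos_fin_gen_recursive_exponents\<close>), provided that this holds for the exceptional \<open>\<kappa>\<close>, at which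
  the sum vanishes.  For \<open>\<delta>\<close> there are finitely many of these, for \<open>\<sigma>\<close> they lie on finitely many
  arithmetic progressions (\<open>pos_fin_gen_exp_fibre\<close>).

  Finally, generators with positive real part can be made linearly independent
  (\<open>pos_fin_gen_independent\<close>): whenever they satisfy a linear relation, a set of fewer generators
  generates a larger semigroup.

  The only fact from analysis that is needed is that the Taylor coefficients of a partial derivative
  of \<open>F\<close> are those of \<open>F\<close>, shifted and multiplied by the index
  (\<open>taylor_coeff_partial_deriv\<close>).  It amounts to the symmetry of mixed partial derivatives, for
  functions assumed to be continuous and holomorphic in each variable.
\<close>

section \<open>Finitely generated semigroups in the right half-plane\<close>

text \<open>The additive submonoid of \<open>\<complex>\<close> generated by a set that may be infinite.\<close>

inductive_set add_hull :: "complex set \<Rightarrow> complex set" for P where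
  zero: "0 \<in> add_hull P"
| step: "p \<in> P \<Longrightarrow> x \<in> add_hull P \<Longrightarrow> p + x \<in> add_hull P"

lemma add_hull_gen: "p \<in> P \<Longrightarrow> p \<in> add_hull P"
  using add_hull.step[OF _ add_hull.zero] by fastforce

lemma add_hull_add: "x \<in> add_hull P \<Longrightarrow> y \<in> add_hull P \<Longrightarrow> x + y \<in> add_hull P"
  by (induction rule: add_hull.induct) (auto simp: add.assoc intro: add_hull.step)

lemma add_hull_subset: "P \<subseteq> add_hull Q \<Longrightarrow> add_hull P \<subseteq> add_hull Q"
proof
  fix x assume "P \<subseteq> add_hull Q" "x \<in> add_hull P"
  from this(2,1) show "x \<in> add_hull Q"
    by (induction rule: add_hull.induct) (auto intro: add_hull.zero add_hull_add)
qed

lemma add_hull_mono: "P \<subseteq> Q \<Longrightarrow> add_hull P \<subseteq> add_hull Q"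
  by (intro add_hull_subset) (auto intro: add_hull_gen)

lemma add_hull_of_nat_mult: "x \<in> add_hull P \<Longrightarrow> of_nat k * x \<in> add_hull P"
  by (induction k) (auto simp: distrib_right intro: add_hull.zero add_hull_add)

lemma add_hull_sum: "(\<And>i. i \<in> I \<Longrightarrow> f i \<in> add_hull P) \<Longrightarrow> (\<Sum>i\<in>I. f i) \<in> add_hull P"
  by (induction I rule: infinite_finite_induct) (auto intro: add_hull.zero add_hull_add)

lemma add_hull_Re_nonneg: "x \<in> add_hull P \<Longrightarrow> (\<And>p. p \<in> P \<Longrightarrow> Re p \<ge> 0) \<Longrightarrow> Re x \<ge> 0"
  by (induction rule: add_hull.induct) fastforce+

lemma add_hull_subset_semigroup_generated:
  assumes "finite P"
  shows "add_hull P \<subseteq> semigroup_generated P"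
proof
  fix x assume "x \<in> add_hull P"
  then show "x \<in> semigroup_generated P"
  proof induction
    case zero
    then show ?case
      unfolding semigroup_generated_def by (auto intro!: exI[of _ "\<lambda>_. 0"])
  next
    case (step p x)
    from step.IH obtain m :: "complex \<Rightarrow> nat" where m: "x = (\<Sum>\<rho>\<in>P. of_nat (m \<rho>) * \<rho>)"
      unfolding semigroup_generated_def by blast
    have "(\<Sum>\<rho>\<in>P. of_nat ((m(p := Suc (m p))) \<rho>) * \<rho>)
        = (\<Sum>\<rho>\<in>P. (if \<rho> = p then p else 0) + of_nat (m \<rho>) * \<rho>)"
      by (rule sum.cong) (auto simp: algebra_simps)
    also have "\<dots> = p + x" using step.hyps assms by (simp add: sum.distrib m)
    finally show ?case unfolding semigroup_generated_def by (intro CollectI exI conjI) (rule sym, auto)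
  qed
qed

lemma finite_add_hull_below:
  assumes "finite P" "\<And>p. p \<in> P \<Longrightarrow> Re p > 0"
  shows "finite {x \<in> add_hull P. Re x \<le> r}"
proof -
  obtain d where d: "d > 0" "\<And>p. p \<in> P \<Longrightarrow> Re p \<ge> d"
  proof
    show "Min (insert 1 (Re ` P)) > 0" using assms by (subst Min_gr_iff) auto
    show "\<And>p. p \<in> P \<Longrightarrow> Re p \<ge> Min (insert 1 (Re ` P))" using assms by (intro Min_le) auto
  qed
  have "finite {x \<in> add_hull P. Re x \<le> of_nat k * d}" for k
  proof (induction k)
    case 0
    have "{x \<in> add_hull P. Re x \<le> of_nat 0 * d} \<subseteq> {0}"
    proof clarify
      fix x assume "x \<in> add_hull P" "Re x \<le> of_nat 0 * d"
      then show "x = 0"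
      proof cases
        case (step p y)
        with d add_hull_Re_nonneg[of y P] assms(2) have "Re x > 0" by (fastforce simp: less_imp_le)
        with \<open>Re x \<le> of_nat 0 * d\<close> show ?thesis by simp
      qed
    qed
    then show ?case by (rule finite_subset) simp
  next
    case (Suc k)
    have "{x \<in> add_hull P. Re x \<le> of_nat (Suc k) * d} \<subseteq>
        insert 0 ((\<lambda>(p, y). p + y) ` (P \<times> {x \<in> add_hull P. Re x \<le> of_nat k * d}))"
    proof clarify
      fix x assume "x \<in> add_hull P" "Re x \<le> of_nat (Suc k) * d"
        "x \<notin> (\<lambda>(p, y). p + y) ` (P \<times> {x \<in> add_hull P. Re x \<le> of_nat k * d})"
      then show "x = 0"
      proof cases
        case (step p y)
        have "Re y \<le> of_nat k * d"
          using d(2)[OF step(2)] \<open>Re x \<le> _\<close> step(1) by (simp add: algebra_simps)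
        with step have "x \<in> (\<lambda>(p, y). p + y) ` (P \<times> {x \<in> add_hull P. Re x \<le> of_nat k * d})"
          by force
        with \<open>x \<notin> _\<close> show ?thesis by blast
      qed
    qed
    then show ?case by (rule finite_subset) (use Suc assms in auto)
  qed
  from this[of "nat \<lceil>r / d\<rceil>"] show ?thesis
  proof (rule finite_subset[rotated])
    have "r / d \<le> real (nat \<lceil>r / d\<rceil>)" by (rule real_nat_ceiling_ge)
    then have "r \<le> real (nat \<lceil>r / d\<rceil>) * d" using d(1) by (simp add: field_simps)
    then show "{x \<in> add_hull P. Re x \<le> r} \<subseteq> {x \<in> add_hull P. Re x \<le> real (nat \<lceil>r / d\<rceil>) * d}"
      by auto
  qed
qed

text \<open>Containment in a semigroup generated by finitely many numbers with positive real part.  The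
  generators need not belong to the set itself.\<close>

definition pos_fin_gen :: "complex set \<Rightarrow> bool" where
  "pos_fin_gen X \<longleftrightarrow> (\<exists>P. finite P \<and> (\<forall>p\<in>P. Re p > 0) \<and> X \<subseteq> add_hull P)"

lemma pos_fin_gen_subset: "pos_fin_gen Y \<Longrightarrow> X \<subseteq> Y \<Longrightarrow> pos_fin_gen X"
  unfolding pos_fin_gen_def by blast

lemma pos_fin_gen_finite: "finite X \<Longrightarrow> (\<And>x. x \<in> X \<Longrightarrow> Re x > 0) \<Longrightarrow> pos_fin_gen X"
  unfolding pos_fin_gen_def by (intro exI[of _ X]) (auto intro: add_hull_gen)

lemma pos_fin_gen_Un:
  assumes "pos_fin_gen X" "pos_fin_gen Y"
  shows "pos_fin_gen (X \<union> Y)"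
proof -
  from assms obtain P Q where "finite P" "\<forall>p\<in>P. Re p > 0" "X \<subseteq> add_hull P"
    "finite Q" "\<forall>p\<in>Q. Re p > 0" "Y \<subseteq> add_hull Q" unfolding pos_fin_gen_def by blast
  with add_hull_mono[of P "P \<union> Q"] add_hull_mono[of Q "P \<union> Q"] show ?thesis
    unfolding pos_fin_gen_def by (intro exI[of _ "P \<union> Q"]) auto
qed

lemma pos_fin_gen_UN:
  "finite I \<Longrightarrow> (\<And>i. i \<in> I \<Longrightarrow> pos_fin_gen (X i)) \<Longrightarrow> pos_fin_gen (\<Union>i\<in>I. X i)"
  by (induction I rule: finite_induct) (auto intro: pos_fin_gen_Un pos_fin_gen_finite)

text \<open>An element of the shifted semigroup with positive real part can lose generators until its
  real part is at most the largest real part of a generator; the finitely many elements so reached, together with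
  the old generators, suffice.\<close>

lemma pos_fin_gen_shift:
  assumes "finite P" "\<And>p. p \<in> P \<Longrightarrow> Re p > 0" "Re a \<ge> 0"
  shows "pos_fin_gen {s - a | s. s \<in> add_hull P \<and> Re s > Re a}"
proof -
  define c where "c = Max (insert 0 (Re ` P))"
  have c: "Re p \<le> c" if "p \<in> P" for p unfolding c_def using that assms by (intro Max_ge) auto
  define B where "B = {s \<in> add_hull P. Re s \<le> Re a + c \<and> Re s > Re a}"
  have "finite B"
    by (rule finite_subset[OF _ finite_add_hull_below[OF assms(1,2), of "Re a + c"]])
      (auto simp: B_def)
  define Q where "Q = P \<union> (\<lambda>s. s - a) ` B"
  have "s - a \<in> add_hull Q" if "s \<in> add_hull P" "Re s > Re a" for s
    using that
  proof induction
    case zero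
    then show ?case using assms(3) by simp
  next
    case (step p x)
    show ?case
    proof (cases "Re x > Re a")
      case True
      then have "p + (x - a) \<in> add_hull Q"
        using step by (intro add_hull.step) (auto simp: Q_def)
      then show ?thesis by (simp add: algebra_simps)
    next
      case False
      then have "p + x \<in> B" using c[OF step(1)] step by (auto simp: B_def intro: add_hull.step)
      then show ?thesis by (intro add_hull_gen) (auto simp: Q_def)
    qed
  qed
  moreover have "finite Q" "\<forall>p\<in>Q. Re p > 0"
    using \<open>finite B\<close> assms by (auto simp: Q_def B_def)
  ultimately show ?thesis unfolding pos_fin_gen_def by (intro exI[of _ Q]) auto
qed

text \<open>If \<open>p\<close> occurs in a linear relation between the generators, write it as
  \<open>N p + \<beta> = \<Sum> a\<^sub>i i\<close>, where \<open>i\<close> runs through the generators with positive coefficient and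
  \<open>\<beta>\<close> collects the remaining ones.  Since \<open>Re \<beta>\<close> is smaller than the real part \<open>A\<close> of the
  right-hand side, suitable rational multiples of \<open>\<beta>\<close> can be subtracted from the generators
  \<open>i\<close> so that the real parts stay positive but \<open>\<beta>\<close> is used up on the right-hand side.\<close>

lemma dependent_generators_reduce:
  fixes a :: "complex \<Rightarrow> int"
  assumes fin: "finite Q" and pos: "\<And>q. q \<in> Q \<Longrightarrow> Re q > 0"
    and rel: "(\<Sum>q\<in>Q. of_int (a q) * q) = 0" and p: "p \<in> Q" "a p < 0"
  shows "\<exists>Q'. finite Q' \<and> card Q' < card Q \<and> (\<forall>q\<in>Q'. Re q > 0) \<and> Q \<subseteq> add_hull Q'"
proof -
  define I where "I = {q \<in> Q. a q > 0}"
  define J where "J = {q \<in> Q - {p}. a q \<le> 0}"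
  have Q: "Q = insert p (I \<union> J)" "p \<notin> I" "p \<notin> J" "I \<inter> J = {}" "finite I" "finite J"
    using p fin by (auto simp: I_def J_def)
  define N where "N = nat (- a p)"
  define b where "b q = nat (- a q)" for q
  define e where "e q = nat (a q)" for q
  define \<beta> where "\<beta> = (\<Sum>j\<in>J. of_nat (b j) * j)"
  define A where "A = (\<Sum>i\<in>I. real (e i) * Re i)"
  have N: "N > 0" using p by (simp add: N_def)
  have rel': "of_nat N * p + \<beta> = (\<Sum>i\<in>I. of_nat (e i) * i)"
  proof -
    have "0 = of_int (a p) * p + ((\<Sum>q\<in>I. of_int (a q) * q) + (\<Sum>q\<in>J. of_int (a q) * q))"
      using rel Q by (simp add: sum.union_disjoint)
    moreover have "(\<Sum>q\<in>I. of_int (a q) * q) = (\<Sum>i\<in>I. of_nat (e i) * i)"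
      by (rule sum.cong) (auto simp: I_def e_def)
    moreover have "(\<Sum>q\<in>J. of_int (a q) * q) = - \<beta>"
      unfolding \<beta>_def sum_negf[symmetric] by (rule sum.cong) (auto simp: J_def b_def)
    moreover have "of_int (a p) = (- of_nat N :: complex)" using p by (simp add: N_def)
    ultimately show ?thesis by (simp add: algebra_simps add_eq_0_iff)
  qed
  have Re_beta: "Re \<beta> \<ge> 0"
    unfolding \<beta>_def Re_sum using pos by (intro sum_nonneg) (auto simp: J_def less_imp_le)
  have "Re (of_nat N * p + \<beta>) = A" unfolding rel' A_def by (simp add: Re_sum)
  moreover have "real N * Re p > 0" using N pos[OF p(1)] by simp
  ultimately have AB: "Re \<beta> < A" by simp
  then have A: "A > 0" using Re_beta by simp
  \<comment> \<open>The multiple of \<open>\<beta>\<close> subtracted from \<open>i\<close> will be \<open>k i / D\<close>, slightly more than \<open>Re i / A\<close>;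
    a large denominator \<open>D\<close> keeps the difference in the right half-plane.\<close>
  obtain D :: nat where D: "D > 0" "\<And>i. i \<in> I \<Longrightarrow> Re \<beta> < real D * (Re i * (1 - Re \<beta> / A))"
  proof -
    define m where "m = Min (insert 1 ((\<lambda>i. Re i * (1 - Re \<beta> / A)) ` I))"
    have "m > 0" unfolding m_def using AB A pos Q(5) by (subst Min_gr_iff) (auto simp: I_def)
    obtain D :: nat where D: "Re \<beta> < real D * m" using reals_Archimedean3[OF \<open>m > 0\<close>] by blast
    show thesis
    proof
      show "D > 0" using D Re_beta by (cases D) auto
      fix i assume "i \<in> I"
      then have "m \<le> Re i * (1 - Re \<beta> / A)" unfolding m_def using Q(5) by (intro Min_le) auto
      then have "real D * m \<le> real D * (Re i * (1 - Re \<beta> / A))" by (intro mult_left_mono) auto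
      with D show "Re \<beta> < real D * (Re i * (1 - Re \<beta> / A))" by simp
    qed
  qed
  define k where "k i = nat \<lfloor>real D * Re i / A\<rfloor> + 1" for i
  have k_gt: "real (k i) > real D * Re i / A" for i
    unfolding k_def by linarith
  have k_le: "real (k i) \<le> real D * Re i / A + 1" if "i \<in> I" for i
  proof -
    have "real D * Re i / A \<ge> 0" using that pos[of i] A by (auto simp: I_def)
    then show ?thesis unfolding k_def by linarith
  qed
  define g where "g q = (if q \<in> I then (q - of_nat (k q) * \<beta> / of_nat D) / of_nat N
      else q / (of_nat N * of_nat D))" for q
  define Q' where "Q' = g ` (Q - {p})"
  have in_hull: "g q \<in> add_hull Q'" if "q \<in> I \<union> J" for q
    using that unfolding Q'_def by (intro add_hull_gen imageI) (use p(2) in \<open>auto simp: I_def J_def\<close>)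
  have gJ: "q = of_nat (N * D) * g q" if "q \<in> J" for q
    using that N D(1) by (auto simp: g_def I_def J_def)
  have beta_div: "\<beta> / of_nat D = (\<Sum>j\<in>J. of_nat (N * b j) * g j)"
  proof -
    have "\<beta> = (\<Sum>j\<in>J. of_nat D * (of_nat (N * b j) * g j))"
      unfolding \<beta>_def using gJ by (intro sum.cong) (auto simp: algebra_simps)
    then show ?thesis using D(1) by (simp add: sum_distrib_left[symmetric])
  qed
  have beta_N: "\<beta> / of_nat D / of_nat N = (\<Sum>j\<in>J. of_nat (b j) * g j)"
    unfolding beta_div using N by (simp add: sum_divide_distrib)
  have gI: "i = of_nat N * g i + of_nat (k i) * (\<beta> / of_nat D)" if "i \<in> I" for i
    using that N by (simp add: g_def)
  have beta_hull: "\<beta> / of_nat D \<in> add_hull Q'"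
    unfolding beta_div by (intro add_hull_sum add_hull_of_nat_mult in_hull) auto
  have Q_hull: "q \<in> add_hull Q'" if "q \<in> I \<union> J" for q
    using that
  proof
    assume q: "q \<in> I"
    then have "of_nat N * g q + of_nat (k q) * (\<beta> / of_nat D) \<in> add_hull Q'"
      by (intro add_hull_add add_hull_of_nat_mult in_hull beta_hull) auto
    then show ?thesis using gI[OF q] by simp
  next
    assume q: "q \<in> J"
    then have "of_nat (N * D) * g q \<in> add_hull Q'" by (intro add_hull_of_nat_mult in_hull) auto
    then show ?thesis using gJ[OF q] by simp
  qed
  define K where "K = (\<Sum>i\<in>I. e i * k i)"
  have "K \<ge> D"
  proof -
    have "real D = (\<Sum>i\<in>I. real (e i) * (real D * Re i / A))"
      using A by (simp add: A_def sum_distrib_left sum_divide_distrib[symmetric] field_simps)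
    also have "\<dots> \<le> (\<Sum>i\<in>I. real (e i) * real (k i))"
      by (intro sum_mono mult_left_mono less_imp_le[OF k_gt]) auto
    also have "\<dots> = real K" by (simp add: K_def)
    finally show ?thesis by simp
  qed
  have "p = (\<Sum>i\<in>I. of_nat (e i) * g i) + of_nat (K - D) * (\<Sum>j\<in>J. of_nat (b j) * g j)"
  proof -
    have "(\<Sum>i\<in>I. of_nat (e i) * i) = (\<Sum>i\<in>I. of_nat N * (of_nat (e i) * g i)
        + of_nat (e i * k i) * (\<beta> / of_nat D))"
    proof (rule sum.cong[OF refl])
      fix i assume i: "i \<in> I"
      show "of_nat (e i) * i = of_nat N * (of_nat (e i) * g i) + of_nat (e i * k i) * (\<beta> / of_nat D)"
        by (subst gI[OF i]) (simp add: algebra_simps)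
    qed
    also have "\<dots> = of_nat N * (\<Sum>i\<in>I. of_nat (e i) * g i) + of_nat K * (\<beta> / of_nat D)"
      by (simp only: sum.distrib sum_distrib_left sum_distrib_right K_def of_nat_sum)
    finally have "of_nat N * p + of_nat D * (\<beta> / of_nat D)
        = of_nat N * (\<Sum>i\<in>I. of_nat (e i) * g i) + of_nat K * (\<beta> / of_nat D)"
      using rel' D(1) by simp
    moreover have "of_nat K = of_nat (K - D) + (of_nat D :: complex)" using \<open>K \<ge> D\<close> by simp
    ultimately have "of_nat N * p
        = of_nat N * (\<Sum>i\<in>I. of_nat (e i) * g i) + of_nat (K - D) * (\<beta> / of_nat D)"
      by (simp add: algebra_simps)
    then have "p = (of_nat N * (\<Sum>i\<in>I. of_nat (e i) * g i) + of_nat (K - D) * (\<beta> / of_nat D)) / of_nat N"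
      using N by (metis nonzero_mult_div_cancel_left of_nat_0_less_iff of_nat_eq_0_iff order_less_irrefl)
    also have "\<dots> = (\<Sum>i\<in>I. of_nat (e i) * g i) + of_nat (K - D) * (\<beta> / of_nat D / of_nat N)"
      using N by (simp add: field_simps)
    finally show ?thesis unfolding beta_N .
  qed
  moreover have "\<dots> \<in> add_hull Q'"
    by (intro add_hull_add add_hull_of_nat_mult add_hull_sum in_hull) auto
  ultimately have "p \<in> add_hull Q'" by simp
  with Q_hull have "Q \<subseteq> add_hull Q'" by (subst Q(1)) auto
  moreover have "Re x > 0" if "x \<in> Q'" for x
  proof -
    from that obtain q where q: "q \<in> Q - {p}" "x = g q" by (auto simp: Q'_def)
    show ?thesis
    proof (cases "q \<in> I")
      case True
      have "real (k q) * Re \<beta> \<le> (real D * Re q / A + 1) * Re \<beta>"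
        using k_le[OF True] Re_beta by (rule mult_right_mono)
      also have "\<dots> < real D * Re q" using D(2)[OF True] by (simp add: algebra_simps)
      finally have "real (k q) * Re \<beta> / real D < Re q" using D(1) by (simp add: field_simps)
      then have "Re (q - of_nat (k q) * \<beta> / of_nat D) > 0" by simp
      then show ?thesis using q True N by (simp add: g_def)
    next
      case False
      have "g q = q / of_nat (N * D)" using False by (simp add: g_def)
      then have "Re (g q) = Re q / real (N * D)" by (simp only: Re_divide_of_nat)
      then show ?thesis using q pos[of q] N D(1) by simp
    qed
  qed
  moreover have "card Q' < card Q"
  proof -
    have "card Q' \<le> card (Q - {p})" unfolding Q'_def using fin by (intro card_image_le) auto
    also have "\<dots> < card Q" using fin p by (intro card_Diff1_less) auto
    finally show ?thesis .
  qed
  moreover have "finite Q'" unfolding Q'_def using fin by simp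
  ultimately show ?thesis by blast
qed

text \<open>A generating set with the least number of elements has to be independent.\<close>

lemma pos_fin_gen_independent:
  assumes "pos_fin_gen X"
  shows "\<exists>P. finite P \<and> (\<forall>\<rho>\<in>P. Re \<rho> > 0) \<and> independent_over_int P \<and>
             X \<subseteq> semigroup_generated P"
proof -
  let ?G = "\<lambda>P. finite P \<and> (\<forall>p\<in>P. Re p > 0) \<and> X \<subseteq> add_hull P"
  from assms obtain P0 where "?G P0" unfolding pos_fin_gen_def by blast
  then obtain P where P: "?G P" and least: "\<And>Q. ?G Q \<Longrightarrow> card P \<le> card Q"
    using ex_has_least_nat[of ?G P0 card] by blast
  have "independent_over_int P"
  proof
    assume "module.dependent (\<lambda>k::int. (*) (of_int k)) P"
    then obtain t and u :: "complex \<Rightarrow> int" and v where t: "finite t" "t \<subseteq> P"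
      "(\<Sum>v\<in>t. of_int (u v) * v) = 0" "v \<in> t" "u v \<noteq> 0"
      unfolding module.dependent_explicit[OF module_int_complex] by blast
    \<comment> \<open>The sign makes the coefficient of \<open>v\<close> negative.\<close>
    define a where "a q = (if q \<in> t then - sgn (u v) * u q else 0)" for q
    have "(\<Sum>q\<in>P. of_int (a q) * q) = (\<Sum>q\<in>t. of_int (- sgn (u v)) * (of_int (u q) * q))"
      using P t by (intro sum.mono_neutral_cong_right) (auto simp: a_def)
    also have "\<dots> = 0" by (simp only: sum_distrib_left[symmetric] t(3)) simp
    finally have rel: "(\<Sum>q\<in>P. of_int (a q) * q) = 0" .
    have "a v < 0" using t by (auto simp: a_def sgn_if)
    with rel P t obtain Q where "finite Q" "card Q < card P" "\<forall>q\<in>Q. Re q > 0" "P \<subseteq> add_hull Q"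
      using dependent_generators_reduce[of P a v] by blast
    moreover from this P have "X \<subseteq> add_hull Q" using add_hull_subset[of P Q] by blast
    ultimately show False using least[of Q] by auto
  qed
  with P add_hull_subset_semigroup_generated[of P] show ?thesis by blast
qed


text \<open>\<open>sum_level P T k\<close> consists of the sums of elements of \<open>P\<close> and \<open>T\<close> with at least \<open>k\<close>
  summands from \<open>T\<close>.\<close>

fun sum_level :: "complex set \<Rightarrow> complex set \<Rightarrow> nat \<Rightarrow> complex set" where
  "sum_level P T 0 = add_hull (P \<union> T)"
| "sum_level P T (Suc k) = {t + m | t m. t \<in> T \<and> m \<in> sum_level P T k}"

lemma sum_level_add_0: "x \<in> add_hull (P \<union> T) \<Longrightarrow> y \<in> sum_level P T k \<Longrightarrow> x + y \<in> sum_level P T k"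
proof (induction k arbitrary: y)
  case (Suc k)
  then obtain t m where "t \<in> T" "m \<in> sum_level P T k" "y = t + m" by auto
  with Suc.IH[of m] Suc.prems(1) have "x + y = t + (x + m)" "x + m \<in> sum_level P T k" by auto
  with \<open>t \<in> T\<close> show ?case unfolding sum_level.simps by blast
qed (auto intro: add_hull_add)

lemma sum_level_add: "x \<in> sum_level P T j \<Longrightarrow> y \<in> sum_level P T k \<Longrightarrow> x + y \<in> sum_level P T (j + k)"
proof (induction j arbitrary: x)
  case (Suc j)
  then obtain t m where "t \<in> T" "m \<in> sum_level P T j" "x = t + m" by auto
  with Suc.IH[of m] Suc.prems(2) have "x + y = t + (m + y)" "m + y \<in> sum_level P T (j + k)" by auto
  with \<open>t \<in> T\<close> show ?case unfolding add_Suc sum_level.simps by blast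
qed (auto intro: sum_level_add_0)

lemma sum_level_Suc_subset: "sum_level P T (Suc k) \<subseteq> sum_level P T k"
proof
  fix x assume "x \<in> sum_level P T (Suc k)"
  then obtain t m where "t \<in> T" "m \<in> sum_level P T k" "x = t + m" by auto
  moreover from this have "t \<in> add_hull (P \<union> T)" by (intro add_hull_gen) simp
  ultimately show "x \<in> sum_level P T k" using sum_level_add_0 by blast
qed

lemma sum_level_1: "t \<in> T \<Longrightarrow> t \<in> sum_level P T (Suc 0)"
  unfolding sum_level.simps by (intro CollectI exI[of _ t] exI[of _ "0::complex"]) (simp add: add_hull.zero)

lemma add_hull_Un_cases:
  "x \<in> add_hull (P \<union> T) \<Longrightarrow> x \<in> add_hull P \<or> x \<in> sum_level P T (Suc 0)"
proof (induction rule: add_hull.induct)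
  case (step p x)
  show ?case
  proof (cases "p \<in> T")
    case True
    with step.hyps have "p + x \<in> sum_level P T (Suc 0)" unfolding sum_level.simps by blast
    then show ?thesis ..
  next
    case False
    with step.hyps have p: "p \<in> P" by blast
    then have "p \<in> add_hull (P \<union> T)" by (intro add_hull_gen) simp
    with step.IH p show ?thesis using add_hull.step sum_level_add_0 by blast
  qed
qed (auto intro: add_hull.zero)

text \<open>Each exponent of \<open>T\<close> outside \<open>X\<close> is obtained from elements of \<open>P\<close> and exponents with
  smaller real part.  In terms of the differences \<open>\<kappa> - \<nu>\<close> the three possibilities become
  \<open>s - 2 \<nu>\<close>, \<open>(s - \<nu>) + (t - \<nu>)\<close> and \<open>(t - \<nu>) + (t' - \<nu>) + m\<close> with \<open>t, t' \<in> T\<close>, which accounts for the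
  choice of the generators.\<close>

lemma pos_fin_gen_recursive_exponents:
  assumes P: "finite P" "\<And>p. p \<in> P \<Longrightarrow> Re p > 0"
    and \<nu>: "\<nu> \<in> add_hull P" and T: "\<And>t. t \<in> T \<Longrightarrow> Re t > Re \<nu>" "\<And>r. finite {t \<in> T. Re t \<le> r}"
    and X: "pos_fin_gen {x - \<nu> | x. x \<in> X}"
    and rec: "\<And>\<kappa>. \<kappa> \<in> T \<Longrightarrow> \<kappa> \<in> X \<or> \<kappa> + \<nu> \<in> add_hull P \<or>
      (\<exists>s\<in>add_hull P. \<exists>t\<in>T. Re s > Re \<nu> \<and> \<kappa> + \<nu> = s + t) \<or> \<kappa> + \<nu> \<in> sum_level P T 2"
  shows "pos_fin_gen (P \<union> T)"
proof -
  have Re_nu: "Re \<nu> \<ge> 0" using \<nu> P(2) by (auto intro: add_hull_Re_nonneg less_imp_le)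
  let ?Y = "P \<union> {s - \<nu> | s. s \<in> add_hull P \<and> Re s > Re \<nu>} \<union>
      {s - 2 * \<nu> | s. s \<in> add_hull P \<and> Re s > Re (2 * \<nu>)} \<union> {x - \<nu> | x. x \<in> X}"
  have "pos_fin_gen ?Y"
    by (intro pos_fin_gen_Un X pos_fin_gen_shift[OF P] pos_fin_gen_finite[OF P]) (use Re_nu in auto)
  then obtain Q where Q: "finite Q" "\<And>q. q \<in> Q \<Longrightarrow> Re q > 0" "?Y \<subseteq> add_hull Q"
    unfolding pos_fin_gen_def by blast
  have PQ: "P \<subseteq> add_hull Q" using Q(3) by blast
  have \<nu>Q: "\<nu> \<in> add_hull Q" using \<nu> add_hull_subset[OF PQ] by blast
  have main: "\<kappa> - \<nu> \<in> add_hull Q" if "\<kappa> \<in> T" for \<kappa>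
    using that
  proof (induction "card {t \<in> T. Re t < Re \<kappa>}" arbitrary: \<kappa> rule: less_induct)
    case less
    have IH: "t - \<nu> \<in> add_hull Q" if t: "t \<in> T" "Re t < Re \<kappa>" for t
    proof (rule less.hyps[OF _ t(1)], rule psubset_card_mono)
      show "finite {t \<in> T. Re t < Re \<kappa>}"
        by (rule finite_subset[OF _ T(2)[of "Re \<kappa>"]]) auto
      show "{s \<in> T. Re s < Re t} \<subset> {s \<in> T. Re s < Re \<kappa>}" using t by auto
    qed
    have IH': "t \<in> add_hull Q" if t: "t \<in> T" "Re t < Re \<kappa>" for t
      using add_hull_add[OF IH[OF t] \<nu>Q] by simp
    have Re_nonneg: "Re p \<ge> 0" if "p \<in> P \<union> T" for p
      using that P(2)[of p] T(1)[of p] Re_nu by auto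
    have small: "m \<in> add_hull Q" if "m \<in> add_hull (P \<union> T)" "Re m < Re \<kappa>" for m
      using that
    proof induction
      case (step p x)
      have "Re x \<ge> 0" using add_hull_Re_nonneg[OF step(2)] Re_nonneg by blast
      with step Re_nonneg[OF step(1)] have "x \<in> add_hull Q" "Re p < Re \<kappa>" by auto
      with step(1) PQ IH'[of p] show ?case by (auto intro: add_hull_add)
    qed (rule add_hull.zero)
    from rec[OF less.prems] consider "\<kappa> \<in> X" | "\<kappa> + \<nu> \<in> add_hull P"
      | s t where "s \<in> add_hull P" "t \<in> T" "Re s > Re \<nu>" "\<kappa> + \<nu> = s + t"
      | "\<kappa> + \<nu> \<in> sum_level P T 2" by blast
    then show ?case
    proof cases
      case 1
      then show ?thesis using Q(3) by blast
    next
      case 2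
      have "\<kappa> - \<nu> = (\<kappa> + \<nu>) - 2 * \<nu>" by simp
      moreover have "Re (\<kappa> + \<nu>) > Re (2 * \<nu>)" using T(1)[OF less.prems] by simp
      ultimately show ?thesis using 2 Q(3) by blast
    next
      case 3
      have "Re t < Re \<kappa>" using arg_cong[OF 3(4), of Re] 3(3) by simp
      with 3 have "t - \<nu> \<in> add_hull Q" by (intro IH)
      moreover have "s - \<nu> \<in> add_hull Q" using 3 Q(3) by blast
      ultimately have hull: "(s - \<nu>) + (t - \<nu>) \<in> add_hull Q" by (rule add_hull_add[rotated])
      have "\<kappa> - \<nu> = (s - \<nu>) + (t - \<nu>)" using 3(4) by (simp add: algebra_simps)
      then show ?thesis by (rule ssubst) (rule hull)
    next
      case 4
      then obtain t u m where t: "t \<in> T" "u \<in> T" "m \<in> add_hull (P \<union> T)" "\<kappa> + \<nu> = t + (u + m)"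
        by (auto simp: numeral_2_eq_2)
      have Re: "Re \<kappa> + Re \<nu> = Re t + (Re u + Re m)" using arg_cong[OF t(4), of Re] by simp
      have "Re m \<ge> 0" using add_hull_Re_nonneg[OF t(3)] Re_nonneg by blast
      with Re T(1)[OF t(1)] T(1)[OF t(2)] Re_nu
      have "Re t < Re \<kappa>" "Re u < Re \<kappa>" "Re m < Re \<kappa>" by linarith+
      with t have hull: "(t - \<nu>) + ((u - \<nu>) + m) \<in> add_hull Q" by (intro add_hull_add IH small)
      have "\<kappa> - \<nu> = (t - \<nu>) + ((u - \<nu>) + m)" using t(4) by (simp add: algebra_simps)
      then show ?thesis by (rule ssubst) (rule hull)
    qed
  qed
  have "P \<union> T \<subseteq> add_hull Q" using PQ add_hull_add[OF main \<nu>Q] by auto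
  with Q show ?thesis unfolding pos_fin_gen_def by blast
qed

section \<open>Taylor coefficients of partial derivatives\<close>

lemma polydisc_upd: "z \<in> polydisc N r \<Longrightarrow> i < N \<Longrightarrow> norm t < r \<Longrightarrow> z(i := t) \<in> polydisc N r"
  by (auto simp: polydisc_def)

lemma polydisc_mono: "r \<le> s \<Longrightarrow> polydisc N r \<subseteq> polydisc N s"
  by (fastforce simp: polydisc_def)

lemma zero_in_polydisc: "r > 0 \<Longrightarrow> (\<lambda>_. 0) \<in> polydisc N r"
  by (simp add: polydisc_def)

lemma tendsto_fun_iff_coordinatewise:
  "(f \<longlongrightarrow> (l :: 'a \<Rightarrow> 'b :: topological_space)) F \<longleftrightarrow> (\<forall>i. ((\<lambda>x. f x i) \<longlongrightarrow> l i) F)"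
proof -
  have "(f \<longlongrightarrow> l) F \<longleftrightarrow> limitin (product_topology (\<lambda>_. euclidean) UNIV) f l F"
    by (simp add: euclidean_product_topology)
  also have "\<dots> \<longleftrightarrow> (\<forall>i. ((\<lambda>x. f x i) \<longlongrightarrow> l i) F)"
    by (simp add: limitin_componentwise)
  finally show ?thesis .
qed

text \<open>Holomorphy on the polydisc of radius \<open>r\<close>, with a bound \<open>C\<close> for the function there.\<close>

definition bounded_holomorphic ::
    "nat \<Rightarrow> real \<Rightarrow> real \<Rightarrow> ((nat \<Rightarrow> complex) \<Rightarrow> complex) \<Rightarrow> bool" where
  "bounded_holomorphic N r C F \<longleftrightarrow> r > 0 \<and> continuous_on (polydisc N r) F \<and>
     (\<forall>z\<in>polydisc N r. \<forall>i<N. (\<lambda>t. F (z(i := t))) holomorphic_on ball 0 r) \<and>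
     (\<forall>z\<in>polydisc N r. norm (F z) \<le> C)"

text \<open>Continuity at \<open>0\<close> gives boundedness near \<open>0\<close>, since the polydiscs shrink to \<open>0\<close>.\<close>

lemma holomorphic_near_0_imp_bounded:
  assumes "holomorphic_near_0 N F"
  obtains r C where "bounded_holomorphic N r C F"
proof -
  from assms obtain r where r: "r > 0" "continuous_on (polydisc N r) F"
    "\<And>z i. z \<in> polydisc N r \<Longrightarrow> i < N \<Longrightarrow> (\<lambda>t. F (z(i := t))) holomorphic_on ball 0 r"
    unfolding holomorphic_near_0_def by blast
  define C where "C = norm (F (\<lambda>_. 0)) + 1"
  have "\<exists>k. \<forall>z\<in>polydisc N (r / real (Suc k)). norm (F z) \<le> C"
  proof (rule ccontr)
    assume "\<not> ?thesis"
    then have "\<forall>k. \<exists>z. z \<in> polydisc N (r / real (Suc k)) \<and> norm (F z) > C"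
      by (auto simp: not_le)
    then obtain z where z: "\<And>k. z k \<in> polydisc N (r / real (Suc k))" "\<And>k. norm (F (z k)) > C"
      by metis
    have "r / real (Suc k) \<le> r" for k using r(1) by (simp add: field_simps)
    then have z_in: "z k \<in> polydisc N r" for k using z(1)[of k] polydisc_mono by blast
    have "(\<lambda>k. z k i) \<longlonglongrightarrow> 0" for i
    proof (cases "i < N")
      case True
      show ?thesis
      proof (rule Lim_null_comparison)
        show "\<forall>\<^sub>F k in sequentially. norm (z k i) \<le> r / real (Suc k)"
          using z(1) True by (auto simp: polydisc_def less_imp_le)
        show "(\<lambda>k. r / real (Suc k)) \<longlonglongrightarrow> 0" by real_asymp
      qed
    next
      case False
      then have "z k i = 0" for k using z(1)[of k] by (auto simp: polydisc_def)
      then show ?thesis by simp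
    qed
    then have "z \<longlonglongrightarrow> (\<lambda>_. 0)" by (simp add: tendsto_fun_iff_coordinatewise)
    with r(2) have "(\<lambda>k. F (z k)) \<longlonglongrightarrow> F (\<lambda>_. 0)"
      by (rule continuous_on_tendsto_compose) (use zero_in_polydisc[OF r(1)] z_in in auto)
    then have "(\<lambda>k. norm (F (z k))) \<longlonglongrightarrow> norm (F (\<lambda>_. 0))" by (rule tendsto_norm)
    then have "\<forall>\<^sub>F k in sequentially. norm (F (z k)) < C"
      by (rule order_tendstoD(2)) (simp add: C_def)
    then obtain k where "norm (F (z k)) < C" by (auto simp: eventually_sequentially)
    with z(2)[of k] show False by simp
  qed
  then obtain k where k: "\<And>z. z \<in> polydisc N (r / real (Suc k)) \<Longrightarrow> norm (F z) \<le> C" by blast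
  have le: "r / real (Suc k) \<le> r" using r(1) by (simp add: field_simps)
  have "bounded_holomorphic N (r / real (Suc k)) C F"
    unfolding bounded_holomorphic_def
  proof (intro conjI ballI allI impI)
    show "r / real (Suc k) > 0" using r(1) by simp
    show "continuous_on (polydisc N (r / real (Suc k))) F"
      using r(2) polydisc_mono[OF le] by (rule continuous_on_subset)
    show "(\<lambda>t. F (z(i := t))) holomorphic_on ball 0 (r / real (Suc k))"
      if "z \<in> polydisc N (r / real (Suc k))" "i < N" for z i
      using that polydisc_mono[OF le] le
      by (intro holomorphic_on_subset[OF r(3)] subset_ball) auto
  qed (use k in auto)
  then show thesis by (rule that)
qed

text \<open>The increments of the difference quotients: they tend to \<open>0\<close> and do not leave the disc of
  radius \<open>r\<close> when starting at distance less than \<open>r / 2\<close> from \<open>0\<close>.\<close>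

lemma step_size:
  assumes "r > 0"
  shows "norm (complex_of_real (r / (8 * real (Suc k)))) = r / (8 * real (Suc k))"
    and "norm (complex_of_real (r / (8 * real (Suc k)))) < r / 4"
    and "complex_of_real (r / (8 * real (Suc k))) \<noteq> 0"
proof -
  show *: "norm (complex_of_real (r / (8 * real (Suc k)))) = r / (8 * real (Suc k))"
    unfolding norm_of_real using assms by simp
  have "r / (8 * real (Suc k)) < r / 4" using assms by (intro divide_strict_left_mono) auto
  then show "norm (complex_of_real (r / (8 * real (Suc k)))) < r / 4" unfolding * .
  show "complex_of_real (r / (8 * real (Suc k))) \<noteq> 0"
    unfolding of_real_eq_0_iff using assms by simp
qed

text \<open>This is Taylor's formula of order one, with the second derivative bounded by Cauchy's
  inequality on discs of radius \<open>r / 8\<close>.\<close>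

lemma difference_quotient_bound:
  assumes g: "g holomorphic_on ball 0 r" and C: "\<And>w. w \<in> ball 0 r \<Longrightarrow> norm (g w) \<le> C"
    and w: "norm w < r / 2" and h: "norm h < r / 4" "h \<noteq> 0"
  shows "norm ((g (w + h) - g w) / h - deriv g w) \<le> 2 * C / (r / 8) ^ 2 * norm h"
proof -
  let ?S = "ball 0 (3 / 4 * r) :: complex set"
  have r: "r > 0" using w norm_ge_zero[of w] by linarith
  have sub: "?S \<subseteq> ball 0 r" using r by (intro subset_ball) auto
  have "norm ((deriv ^^ 0) g (w + h) - (\<Sum>i\<le>1. (deriv ^^ i) g w * (w + h - w) ^ i / fact i))
      \<le> 2 * C / (r / 8) ^ 2 * norm (w + h - w) ^ Suc 1 / fact 1"
  proof (rule complex_Taylor[of ?S])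
    fix i and x :: complex assume "x \<in> ?S"
    then show "((deriv ^^ i) g has_field_derivative (deriv ^^ Suc i) g x) (at x within ?S)"
      using g sub by (intro has_field_derivative_at_within[OF has_field_derivative_higher_deriv[of _ "ball 0 r"]])
        auto
  next
    fix x :: complex assume x: "x \<in> ?S"
    have sub': "cball x (r / 8) \<subseteq> ball 0 r"
    proof
      fix y assume "y \<in> cball x (r / 8)"
      then have "norm (y - x) \<le> r / 8" by (simp add: dist_norm norm_minus_commute)
      then have "norm y \<le> r / 8 + norm x" using norm_triangle_sub[of y x] by linarith
      then show "y \<in> ball 0 r" using x r by simp
    qed
    have "norm ((deriv ^^ 2) g x) \<le> fact 2 * C / (r / 8) ^ 2"
    proof (rule Cauchy_inequality)
      show "g holomorphic_on ball x (r / 8)"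
        using g sub' by (meson ball_subset_cball holomorphic_on_subset)
      show "continuous_on (cball x (r / 8)) g"
        using holomorphic_on_imp_continuous_on[OF g] sub' by (rule continuous_on_subset)
      show "norm (g y) \<le> C" if "norm (x - y) = r / 8" for y
        by (rule C, rule subsetD[OF sub']) (use that in \<open>simp add: dist_norm\<close>)
    qed (use r in simp)
    then show "norm ((deriv ^^ Suc 1) g x) \<le> 2 * C / (r / 8) ^ 2" by (simp add: numeral_2_eq_2)
  next
    show "w \<in> ?S" using w r by simp
    show "w + h \<in> ?S" using w h norm_triangle_ineq[of w h] by simp
  qed simp
  then have *: "norm (g (w + h) - g w - deriv g w * h) \<le> 2 * C / (r / 8) ^ 2 * norm h * norm h"
    by (simp add: power2_eq_square algebra_simps)
  have "norm ((g (w + h) - g w) / h - deriv g w) = norm (g (w + h) - g w - deriv g w * h) / norm h"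
    using h by (simp add: norm_divide[symmetric] field_simps)
  also have "\<dots> \<le> 2 * C / (r / 8) ^ 2 * norm h"
    using * h by (simp add: divide_le_eq)
  finally show ?thesis .
qed

text \<open>The difference quotients with respect to one variable converge uniformly.  Hence the partial
  derivative is again continuous and holomorphic in each variable, and a further derivative
  in another variable may be taken before passing to the limit.\<close>

lemma partial_deriv_uniform_limit:
  assumes F: "bounded_holomorphic N r C F" and i: "i < N"
  defines "h \<equiv> \<lambda>k. complex_of_real (r / (8 * real (Suc k)))"
  shows "uniform_limit (polydisc N (r / 2)) (\<lambda>k z. (F (z(i := z i + h k)) - F z) / h k)
           (partial_deriv i F) sequentially"
proof (rule uniform_limitI)
  fix e :: real assume e: "e > 0"
  have r: "r > 0" using F by (simp add: bounded_holomorphic_def)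
  define B where "B = 2 * C / (r / 8) ^ 2"
  have "(\<lambda>k. B * (r / (8 * real (Suc k)))) \<longlonglongrightarrow> 0" by real_asymp
  then have "\<forall>\<^sub>F k in sequentially. B * (r / (8 * real (Suc k))) < e"
    using e by (rule order_tendstoD)
  then show "\<forall>\<^sub>F k in sequentially. \<forall>z\<in>polydisc N (r / 2).
      dist ((F (z(i := z i + h k)) - F z) / h k) (partial_deriv i F z) < e"
  proof eventually_elim
    case (elim k)
    show ?case
    proof
      fix z assume z: "z \<in> polydisc N (r / 2)"
      then have z': "z \<in> polydisc N r" using polydisc_mono[of "r / 2" r] r by auto
      have hk: "norm (h k) = r / (8 * real (Suc k))" unfolding h_def by (rule step_size[OF r])
      have "norm ((F (z(i := z i + h k)) - F (z(i := z i))) / h k - deriv (\<lambda>t. F (z(i := t))) (z i))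
          \<le> 2 * C / (r / 8) ^ 2 * norm (h k)"
      proof (rule difference_quotient_bound)
        show "(\<lambda>t. F (z(i := t))) holomorphic_on ball 0 r"
          using F z' i by (simp add: bounded_holomorphic_def)
        show "norm (F (z(i := t))) \<le> C" if "t \<in> ball 0 r" for t
          using F polydisc_upd[OF z' i] that by (simp add: bounded_holomorphic_def)
        show "norm (z i) < r / 2" using z i by (simp add: polydisc_def)
        show "norm (h k) < r / 4" "h k \<noteq> 0" unfolding h_def by (rule step_size[OF r])+
      qed
      with elim show "dist ((F (z(i := z i + h k)) - F z) / h k) (partial_deriv i F z) < e"
        by (simp add: dist_norm partial_deriv_def hk B_def)
    qed
  qed
qed

lemma partial_deriv_bounded_holomorphic:
  assumes F: "bounded_holomorphic N r C F" and i: "i < N" and j: "j < N" and z: "z \<in> polydisc N (r / 2)"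
  defines "h \<equiv> \<lambda>k. complex_of_real (r / (8 * real (Suc k)))"
  shows "continuous_on (polydisc N (r / 2)) (partial_deriv i F)" (is ?cont)
    and "(\<lambda>t. partial_deriv i F (z(j := t))) holomorphic_on ball 0 (r / 2)" (is ?hol)
    and "(\<lambda>k. deriv (\<lambda>t. (F (z(j := t, i := (z(j := t)) i + h k)) - F (z(j := t))) / h k) (z j))
           \<longlonglongrightarrow> partial_deriv j (partial_deriv i F) z" (is ?lim)
proof -
  have r: "r > 0" using F by (simp add: bounded_holomorphic_def)
  define q where "q k z = (F (z(i := z i + h k)) - F z) / h k" for k z
  have ul: "uniform_limit (polydisc N (r / 2)) q (partial_deriv i F) sequentially"
    unfolding q_def h_def by (rule partial_deriv_uniform_limit[OF F i])
  have h: "norm (h k) < r / 2" "h k \<noteq> 0" for k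
    using step_size(2,3)[OF r, of k] r by (auto simp: h_def)
  have half: "polydisc N (r / 2) \<subseteq> polydisc N r" using r by (intro polydisc_mono) simp
  have shift: "z(i := z i + h k) \<in> polydisc N r" if "z \<in> polydisc N (r / 2)" for z k
  proof (rule polydisc_upd[OF subsetD[OF half that] i])
    show "norm (z i + h k) < r"
      using that i h(1)[of k] norm_triangle_ineq[of "z i" "h k"] by (auto simp: polydisc_def)
  qed
  show ?cont
  proof (rule uniform_limit_theorem[OF always_eventually ul], rule allI)
    fix k
    have Fc: "continuous_on (polydisc N r) F" using F by (simp add: bounded_holomorphic_def)
    have "continuous_on (polydisc N (r / 2)) (\<lambda>z. z(i := z i + h k))"
    proof (rule continuous_on_coordinatewise_then_product)
      fix m
      show "continuous_on (polydisc N (r / 2)) (\<lambda>z. (z(i := z i + h k)) m)"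
        by (cases "m = i") (auto intro!: continuous_intros continuous_on_product_coordinates
            continuous_on_subset[OF continuous_on_product_coordinates])
    qed
    then have "continuous_on (polydisc N (r / 2)) (\<lambda>z. F (z(i := z i + h k)))"
      by (rule continuous_on_compose2[OF Fc]) (use shift in auto)
    then show "continuous_on (polydisc N (r / 2)) (q k)"
      unfolding q_def using h continuous_on_subset[OF Fc half] by (intro continuous_intros) auto
  qed simp
  have z': "z \<in> polydisc N r" using z half by blast
  have Fhol: "(\<lambda>t. F (y(m := t))) holomorphic_on ball 0 r" if "y \<in> polydisc N r" "m < N" for y m
    using F that by (simp add: bounded_holomorphic_def)
  have upd: "z(j := t) \<in> polydisc N (r / 2)" if "t \<in> ball 0 (r / 2)" for t
    using z j that by (intro polydisc_upd) auto
  have hol1: "(\<lambda>t. F (z(j := t, i := (z(j := t)) i + h k))) holomorphic_on ball 0 (r / 2)" for k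
  proof (cases "i = j")
    case True
    have "(\<lambda>t. F (z(j := t))) \<circ> (\<lambda>t. t + h k) holomorphic_on ball 0 (r / 2)"
    proof (rule holomorphic_on_compose_gen[OF _ Fhol[OF z' j]])
      show "(\<lambda>t. t + h k) ` ball 0 (r / 2) \<subseteq> ball 0 r"
      proof clarify
        fix t :: complex assume "t \<in> ball 0 (r / 2)"
        then show "t + h k \<in> ball 0 r" using h(1)[of k] norm_triangle_ineq[of t "h k"] by simp
      qed
    qed (intro holomorphic_intros)
    then show ?thesis using True by (simp add: o_def)
  next
    case False
    have "(\<lambda>t. F ((z(i := z i + h k))(j := t))) holomorphic_on ball 0 (r / 2)"
      by (rule holomorphic_on_subset[OF Fhol[OF shift[OF z] j]]) (use r in auto)
    then show ?thesis using False by (simp add: fun_upd_twist)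
  qed
  have hol2: "(\<lambda>t. F (z(j := t))) holomorphic_on ball 0 (r / 2)"
    by (rule holomorphic_on_subset[OF Fhol[OF z' j]]) (use r in auto)
  have "\<exists>g'. \<forall>x\<in>ball 0 (r / 2). ((\<lambda>t. partial_deriv i F (z(j := t))) has_field_derivative g' x) (at x)
      \<and> (\<lambda>k. deriv (\<lambda>t. q k (z(j := t))) x) \<longlonglongrightarrow> g' x"
  proof (rule has_complex_derivative_uniform_sequence)
    fix k and x :: complex assume "x \<in> ball 0 (r / 2)"
    moreover have "(\<lambda>t. q k (z(j := t))) holomorphic_on ball 0 (r / 2)"
      unfolding q_def using h(2) by (intro holomorphic_intros hol1 hol2) auto
    ultimately show "((\<lambda>t. q k (z(j := t))) has_field_derivative deriv (\<lambda>t. q k (z(j := t))) x) (at x)"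
      by (intro holomorphic_derivI[of _ "ball 0 (r / 2)"]) auto
  next
    fix x :: complex assume "x \<in> ball 0 (r / 2)"
    then obtain d where d: "d > 0" "cball x d \<subseteq> ball 0 (r / 2)"
      using open_contains_cball[of "ball 0 (r / 2)"] by blast
    have "uniform_limit (cball x d) (\<lambda>k t. q k (z(j := t))) (\<lambda>t. partial_deriv i F (z(j := t))) sequentially"
      by (rule uniform_limit_compose'[OF ul]) (use d upd in blast)
    with d show "\<exists>d>0. cball x d \<subseteq> ball 0 (r / 2) \<and>
        uniform_limit (cball x d) (\<lambda>k t. q k (z(j := t))) (\<lambda>t. partial_deriv i F (z(j := t))) sequentially"
      by blast
  qed simp
  then obtain g' where g': "\<And>x. x \<in> ball 0 (r / 2) \<Longrightarrow>
      ((\<lambda>t. partial_deriv i F (z(j := t))) has_field_derivative g' x) (at x)"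
    "\<And>x. x \<in> ball 0 (r / 2) \<Longrightarrow> (\<lambda>k. deriv (\<lambda>t. q k (z(j := t))) x) \<longlonglongrightarrow> g' x" by blast
  show ?hol
    unfolding holomorphic_on_open[OF open_ball] using g'(1) by blast
  have zj: "z j \<in> ball 0 (r / 2)" using z j by (simp add: polydisc_def)
  have "partial_deriv j (partial_deriv i F) z = g' (z j)"
    unfolding partial_deriv_def[of j] using g'(1)[OF zj] by (rule DERIV_imp_deriv)
  with g'(2)[OF zj] show ?lim unfolding q_def by simp
qed

lemma holomorphic_near_0_partial_deriv:
  assumes "holomorphic_near_0 N F" "i < N"
  shows "holomorphic_near_0 N (partial_deriv i F)"
proof -
  obtain r C where F: "bounded_holomorphic N r C F"
    using assms(1) by (rule holomorphic_near_0_imp_bounded)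
  then have r: "r / 2 > 0" by (simp add: bounded_holomorphic_def)
  show ?thesis
    unfolding holomorphic_near_0_def
    using partial_deriv_bounded_holomorphic(1)[OF F assms(2,2) zero_in_polydisc[OF r]]
      partial_deriv_bounded_holomorphic(2)[OF F assms(2)] r by blast
qed

text \<open>Equality of germs at \<open>0\<close>.  Commutation of partial derivatives is stated for germs, because
  the polydisc is made smaller with every derivative.\<close>

definition germ_eq ::
    "nat \<Rightarrow> ((nat \<Rightarrow> complex) \<Rightarrow> complex) \<Rightarrow> ((nat \<Rightarrow> complex) \<Rightarrow> complex) \<Rightarrow> bool" where
  "germ_eq N F G \<longleftrightarrow> (\<exists>r>0. \<forall>z\<in>polydisc N r. F z = G z)"

lemma germ_eq_refl: "germ_eq N F F"
  unfolding germ_eq_def by (rule exI[of _ 1]) simp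

lemma germ_eq_trans: "germ_eq N F G \<Longrightarrow> germ_eq N G H \<Longrightarrow> germ_eq N F H"
proof -
  assume "germ_eq N F G" "germ_eq N G H"
  then obtain r s where "r > 0" "s > 0" "\<forall>z\<in>polydisc N r. F z = G z" "\<forall>z\<in>polydisc N s. G z = H z"
    unfolding germ_eq_def by blast
  with polydisc_mono[of "min r s" r N] polydisc_mono[of "min r s" s N]
  show ?thesis unfolding germ_eq_def by (intro exI[of _ "min r s"]) (auto dest!: subsetD)
qed

lemma germ_eq_at_0: "germ_eq N F G \<Longrightarrow> F (\<lambda>_. 0) = G (\<lambda>_. 0)"
  unfolding germ_eq_def using zero_in_polydisc by blast

lemma germ_eq_partial_deriv:
  assumes "germ_eq N F G" "i < N"
  shows "germ_eq N (partial_deriv i F) (partial_deriv i G)"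
proof -
  from assms(1) obtain r where r: "r > 0" "\<And>z. z \<in> polydisc N r \<Longrightarrow> F z = G z"
    unfolding germ_eq_def by blast
  have "partial_deriv i F z = partial_deriv i G z" if z: "z \<in> polydisc N r" for z
  proof -
    have "z i \<in> ball 0 r" using z assms(2) by (simp add: polydisc_def)
    then have "\<forall>\<^sub>F t in nhds (z i). t \<in> ball 0 r" by (intro eventually_nhds_in_open) auto
    then have "\<forall>\<^sub>F t in nhds (z i). F (z(i := t)) = G (z(i := t))"
      by eventually_elim (use z assms(2) in \<open>auto intro!: r(2) polydisc_upd\<close>)
    then show ?thesis unfolding partial_deriv_def by (rule deriv_cong_ev) simp
  qed
  with r(1) show ?thesis unfolding germ_eq_def by blast
qed

lemma germ_eq_partial_deriv_commute:
  assumes "holomorphic_near_0 N F" "i < N" "j < N"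
  shows "germ_eq N (partial_deriv i (partial_deriv j F)) (partial_deriv j (partial_deriv i F))"
proof (cases "i = j")
  case False
  obtain r C where F: "bounded_holomorphic N r C F"
    using assms(1) by (rule holomorphic_near_0_imp_bounded)
  then have r: "r > 0" by (simp add: bounded_holomorphic_def)
  define h where "h k = complex_of_real (r / (8 * real (Suc k)))" for k
  have h: "norm (h k) < r / 2" "h k \<noteq> 0" for k
    using step_size(2,3)[OF r, of k] r by (auto simp: h_def)
  have "partial_deriv i (partial_deriv j F) z = partial_deriv j (partial_deriv i F) z"
    if z: "z \<in> polydisc N (r / 2)" for z
  proof (rule LIMSEQ_unique)
    let ?u = "\<lambda>k. (partial_deriv j F (z(i := z i + h k)) - partial_deriv j F z) / h k"
    have zi: "z i \<in> ball 0 (r / 2)" and zj: "z j \<in> ball 0 r"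
      using z assms(2,3) r by (auto simp: polydisc_def)
    have z': "z \<in> polydisc N r" using z polydisc_mono[of "r / 2" r N] r by auto
    have Fhol: "(\<lambda>t. F (y(j := t))) field_differentiable at (z j)" if "y \<in> polydisc N r" for y
      using F that assms(3) zj
      by (intro holomorphic_on_imp_differentiable_at[of _ "ball 0 r"])
        (auto simp: bounded_holomorphic_def)
    have "((\<lambda>t. partial_deriv j F (z(i := t))) has_field_derivative
        partial_deriv i (partial_deriv j F) z) (at (z i))"
      unfolding partial_deriv_def[of i]
      using partial_deriv_bounded_holomorphic(2)[OF F assms(3,2) z] zi
      by (intro holomorphic_derivI[of _ "ball 0 (r / 2)"]) auto
    then have "((\<lambda>d. (partial_deriv j F (z(i := z i + d)) - partial_deriv j F (z(i := z i))) / d)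
        \<longlongrightarrow> partial_deriv i (partial_deriv j F) z) (at 0)"
      by (simp add: DERIV_def)
    moreover have "filterlim h (at 0) sequentially"
    proof (rule filterlim_atI)
      have "(\<lambda>k. r / (8 * real (Suc k))) \<longlonglongrightarrow> 0" by real_asymp
      then show "h \<longlonglongrightarrow> 0" unfolding h_def by (metis of_real_0 tendsto_of_real)
    qed (use h in auto)
    ultimately show "?u \<longlonglongrightarrow> partial_deriv i (partial_deriv j F) z"
      by (auto dest: filterlim_compose)
    have "deriv (\<lambda>t. (F (z(j := t, i := (z(j := t)) i + h k)) - F (z(j := t))) / h k) (z j) = ?u k" for k
    proof -
      have "z(i := z i + h k) \<in> polydisc N r"
      proof (rule polydisc_upd[OF z' assms(2)])
        show "norm (z i + h k) < r" using zi h(1)[of k] norm_triangle_ineq[of "z i" "h k"] by simp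
      qed
      from Fhol[OF this] have "(\<lambda>t. F (z(j := t, i := z i + h k))) field_differentiable at (z j)"
        using False by (simp add: fun_upd_twist)
      with Fhol[OF z'] show ?thesis
        using False h(2)[of k] by (simp add: partial_deriv_def deriv_cdivide_right fun_upd_twist
            field_differentiable_diff power2_eq_square)
    qed
    with partial_deriv_bounded_holomorphic(3)[OF F assms(2,3) z]
    show "?u \<longlonglongrightarrow> partial_deriv j (partial_deriv i F) z" unfolding h_def by simp
  qed
  with r show ?thesis unfolding germ_eq_def by (intro exI[of _ "r / 2"]) auto
qed (simp add: germ_eq_refl)

lemma holomorphic_near_0_partial_deriv_funpow:
  "holomorphic_near_0 N F \<Longrightarrow> i < N \<Longrightarrow> holomorphic_near_0 N ((partial_deriv i ^^ k) F)"
  by (induction k) (auto intro: holomorphic_near_0_partial_deriv)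

lemma germ_eq_partial_deriv_funpow:
  "germ_eq N F G \<Longrightarrow> i < N \<Longrightarrow> germ_eq N ((partial_deriv i ^^ k) F) ((partial_deriv i ^^ k) G)"
  by (induction k) (auto intro: germ_eq_partial_deriv)

lemma germ_eq_partial_deriv_funpow_commute:
  assumes "holomorphic_near_0 N F" "i < N" "j < N"
  shows "germ_eq N ((partial_deriv i ^^ k) (partial_deriv j F)) (partial_deriv j ((partial_deriv i ^^ k) F))"
proof (induction k)
  case (Suc k)
  from germ_eq_partial_deriv[OF Suc assms(2)]
    germ_eq_partial_deriv_commute[OF holomorphic_near_0_partial_deriv_funpow[OF assms(1,2)] assms(2,3)]
  show ?case by (auto intro: germ_eq_trans)
qed (simp add: germ_eq_refl)

lemma foldr_partial_deriv_commute:
  assumes "holomorphic_near_0 N F" "set xs \<subseteq> {..<N}" "j < N"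
  shows "holomorphic_near_0 N (foldr (\<lambda>i. partial_deriv i ^^ \<alpha> i) xs F) \<and>
    germ_eq N (foldr (\<lambda>i. partial_deriv i ^^ \<alpha> i) xs (partial_deriv j F))
      (partial_deriv j (foldr (\<lambda>i. partial_deriv i ^^ \<alpha> i) xs F))"
  using assms(2)
proof (induction xs)
  case (Cons x xs)
  then have IH: "holomorphic_near_0 N (foldr (\<lambda>i. partial_deriv i ^^ \<alpha> i) xs F)"
    "germ_eq N (foldr (\<lambda>i. partial_deriv i ^^ \<alpha> i) xs (partial_deriv j F))
      (partial_deriv j (foldr (\<lambda>i. partial_deriv i ^^ \<alpha> i) xs F))" and x: "x < N" by auto
  from germ_eq_partial_deriv_funpow[OF IH(2) x]
    germ_eq_partial_deriv_funpow_commute[OF IH(1) x assms(3)] IH(1) x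
  show ?case by (auto intro: germ_eq_trans holomorphic_near_0_partial_deriv_funpow)
qed (simp add: assms germ_eq_refl)

lemma foldr_partial_deriv_Suc:
  assumes "holomorphic_near_0 N F" "set xs \<subseteq> {..<N}" "distinct xs" "j \<in> set xs"
  shows "germ_eq N (foldr (\<lambda>i. partial_deriv i ^^ \<alpha> i) xs (partial_deriv j F))
      (foldr (\<lambda>i. partial_deriv i ^^ (\<alpha>(j := Suc (\<alpha> j))) i) xs F)"
  using assms(2-4)
proof (induction xs)
  case (Cons x xs)
  show ?case
  proof (cases "x = j")
    case True
    with Cons.prems have "foldr (\<lambda>i. partial_deriv i ^^ (\<alpha>(j := Suc (\<alpha> j))) i) xs F
        = foldr (\<lambda>i. partial_deriv i ^^ \<alpha> i) xs F"
      by (intro foldr_cong) auto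
    moreover have "germ_eq N ((partial_deriv j ^^ \<alpha> j) (foldr (\<lambda>i. partial_deriv i ^^ \<alpha> i) xs (partial_deriv j F)))
      ((partial_deriv j ^^ \<alpha> j) (partial_deriv j (foldr (\<lambda>i. partial_deriv i ^^ \<alpha> i) xs F)))"
      using foldr_partial_deriv_commute[OF assms(1), of xs j \<alpha>] Cons.prems True
      by (intro germ_eq_partial_deriv_funpow) auto
    ultimately show ?thesis using True by (simp add: funpow_swap1)
  next
    case False
    with Cons show ?thesis by (auto intro: germ_eq_partial_deriv_funpow)
  qed
qed simp

lemma taylor_coeff_partial_deriv:
  assumes "holomorphic_near_0 N F" "j < N"
  shows "taylor_coeff N (partial_deriv j F) \<alpha>
    = of_nat (Suc (\<alpha> j)) * taylor_coeff N F (\<alpha>(j := Suc (\<alpha> j)))"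
proof -
  have "foldr (\<lambda>i. partial_deriv i ^^ \<alpha> i) [0..<N] (partial_deriv j F) (\<lambda>_. 0)
      = foldr (\<lambda>i. partial_deriv i ^^ (\<alpha>(j := Suc (\<alpha> j))) i) [0..<N] F (\<lambda>_. 0)"
    by (rule germ_eq_at_0[OF foldr_partial_deriv_Suc]) (use assms in auto)
  moreover have "(\<Prod>i<N. fact ((\<alpha>(j := Suc (\<alpha> j))) i) :: complex) = of_nat (Suc (\<alpha> j)) * (\<Prod>i<N. fact (\<alpha> i))"
    using assms(2) by (simp add: prod.remove[of "{..<N}" j] mult.assoc)
  ultimately show ?thesis by (simp add: taylor_coeff_def del: of_nat_Suc)
qed

section \<open>Exponents of substituted series\<close>

lemma gps_coeff_add: "gps_coeff (f + g) a = gps_coeff f a + gps_coeff g a"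
  by (simp add: plus_gps.rep_eq)

lemma gps_coeff_uminus: "gps_coeff (- f) a = - gps_coeff f a"
  by (simp add: uminus_gps.rep_eq)

lemma gps_coeff_diff: "gps_coeff (f - g) a = gps_coeff f a - gps_coeff g a"
  unfolding minus_gps_def gps_coeff_add gps_coeff_uminus by simp

lemma gps_coeff_zero: "gps_coeff 0 a = 0"
  by (simp add: zero_gps.rep_eq)

lemma gps_coeff_sum: "gps_coeff (\<Sum>i\<in>I. f i) a = (\<Sum>i\<in>I. gps_coeff (f i) a)"
  by (induction I rule: infinite_finite_induct) (auto simp: gps_coeff_add gps_coeff_zero)

lemma gps_coeff_of_nat_mult: "gps_coeff (of_nat k * f) a = of_nat k * gps_coeff f a"
  by (induction k) (auto simp: gps_coeff_add gps_coeff_zero distrib_right)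

lemma gps_exponents_in_zero: "0 \<in> gps_exponents_in A"
  by (simp add: gps_exponents_in_def gps_coeff_zero)

lemma gps_exponents_in_add: "f \<in> gps_exponents_in A \<Longrightarrow> g \<in> gps_exponents_in A \<Longrightarrow> f + g \<in> gps_exponents_in A"
  unfolding gps_exponents_in_def mem_Collect_eq gps_coeff_add by (metis add_0)

lemma gps_exponents_in_uminus: "f \<in> gps_exponents_in A \<Longrightarrow> - f \<in> gps_exponents_in A"
  by (simp add: gps_exponents_in_def gps_coeff_uminus)

lemma gps_exponents_in_mono: "f \<in> gps_exponents_in A \<Longrightarrow> A \<subseteq> B \<Longrightarrow> f \<in> gps_exponents_in B"
  by (auto simp: gps_exponents_in_def)

lemma gps_exponents_in_mult:
  assumes "f \<in> gps_exponents_in A" "g \<in> gps_exponents_in B"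
    "\<And>a b. a \<in> A \<Longrightarrow> b \<in> B \<Longrightarrow> a + b \<in> C"
  shows "f * g \<in> gps_exponents_in C"
  unfolding gps_exponents_in_def
proof (intro CollectI allI impI)
  fix a assume "gps_coeff (f * g) a \<noteq> 0"
  then obtain b where "gps_coeff f b \<noteq> 0" "gps_coeff g (a - b) \<noteq> 0" by (rule gps_mult_nonzeroE)
  then have "b \<in> A" "a - b \<in> B" using assms(1,2) by (auto simp: gps_exponents_in_def)
  then show "a \<in> C" using assms(3)[of b "a - b"] by simp
qed

lemma gps_exponents_in_hull_one: "1 \<in> gps_exponents_in (add_hull Q)"
  by (auto simp: gps_exponents_in_def one_gps.rep_eq add_hull.zero split: if_splits)

lemma gps_exponents_in_hull_power:
  "f \<in> gps_exponents_in (add_hull Q) \<Longrightarrow> f ^ k \<in> gps_exponents_in (add_hull Q)"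
  by (induction k) (auto intro: gps_exponents_in_hull_one gps_exponents_in_mult add_hull_add)

lemma gps_exponents_in_hull_prod:
  "(\<And>i. i \<in> I \<Longrightarrow> f i \<in> gps_exponents_in (add_hull Q)) \<Longrightarrow> (\<Prod>i\<in>I. f i) \<in> gps_exponents_in (add_hull Q)"
  by (induction I rule: infinite_finite_induct)
    (auto intro: gps_exponents_in_hull_one gps_exponents_in_mult add_hull_add)

lemma gps_subst_exponents_in:
  assumes "\<And>i. i < N \<Longrightarrow> gps_coeff (G i) 0 = 0"
    and "\<And>i. i < N \<Longrightarrow> G i \<in> gps_exponents_in (add_hull Q)"
  shows "gps_subst N F G \<in> gps_exponents_in (add_hull Q)"
  unfolding gps_exponents_in_def
proof (intro CollectI allI impI)
  fix a assume "gps_coeff (gps_subst N F G) a \<noteq> 0"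
  moreover have "gps_coeff (gps_subst N F G) a =
      (\<Sum>\<alpha> | \<alpha> \<in> multi_indices N \<and> gps_coeff (\<Prod>i<N. G i ^ \<alpha> i) a \<noteq> 0.
        taylor_coeff N F \<alpha> * gps_coeff (\<Prod>i<N. G i ^ \<alpha> i) a)"
    by (rule gps_coeff_subst) (rule assms(1))
  ultimately obtain \<alpha> where "gps_coeff (\<Prod>i<N. G i ^ \<alpha> i) a \<noteq> 0"
    by (metis (no_types, lifting) mult_zero_right sum.neutral)
  moreover have "(\<Prod>i<N. G i ^ \<alpha> i) \<in> gps_exponents_in (add_hull Q)"
    by (intro gps_exponents_in_hull_prod gps_exponents_in_hull_power assms(2)) auto
  ultimately show "a \<in> add_hull Q" by (simp add: gps_exponents_in_def)
qed

section \<open>Taylor expansion to first order\<close>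

text \<open>\<open>f0\<close> and \<open>f1\<close> are terms of order zero and one of \<open>f\<close>: \<open>f = f0 + f1\<close> up to a
  remainder whose exponents contain at least two summands from \<open>T\<close>.\<close>

definition first_order :: "complex set \<Rightarrow> complex set \<Rightarrow> gps \<Rightarrow> gps \<Rightarrow> gps \<Rightarrow> bool" where
  "first_order P T f f0 f1 \<longleftrightarrow> f0 \<in> gps_exponents_in (sum_level P T 0) \<and>
     f1 \<in> gps_exponents_in (sum_level P T 1) \<and> f - (f0 + f1) \<in> gps_exponents_in (sum_level P T 2)"

lemma gps_exponents_in_level_mult:
  "f \<in> gps_exponents_in (sum_level P T j) \<Longrightarrow> g \<in> gps_exponents_in (sum_level P T k) \<Longrightarrow>
    f * g \<in> gps_exponents_in (sum_level P T (j + k))"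
  by (rule gps_exponents_in_mult) (auto intro: sum_level_add)

lemma gps_exponents_in_level_mono:
  "f \<in> gps_exponents_in (sum_level P T j) \<Longrightarrow> k \<le> j \<Longrightarrow> f \<in> gps_exponents_in (sum_level P T k)"
  by (erule gps_exponents_in_mono, rule lift_Suc_antimono_le[of "sum_level P T"])
    (rule sum_level_Suc_subset)

lemma first_order_mult:
  assumes "first_order P T f f0 f1" "first_order P T g g0 g1"
  shows "first_order P T (f * g) (f0 * g0) (f0 * g1 + f1 * g0)"
proof -
  define f2 where "f2 = f - (f0 + f1)"
  define g2 where "g2 = g - (g0 + g1)"
  let ?E = "\<lambda>k. gps_exponents_in (sum_level P T k)"
  have f: "f0 \<in> ?E 0" "f1 \<in> ?E 1" "f2 \<in> ?E 2" and g: "g0 \<in> ?E 0" "g1 \<in> ?E 1" "g2 \<in> ?E 2"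
    using assms by (auto simp: first_order_def f2_def g2_def)
  have "f1 \<in> ?E 0" "g1 \<in> ?E 0" "g2 \<in> ?E 0"
    using gps_exponents_in_level_mono[OF f(2), of 0] gps_exponents_in_level_mono[OF g(2), of 0]
      gps_exponents_in_level_mono[OF g(3), of 0] by blast+
  then have "f0 + f1 \<in> ?E 0" "g0 + g1 + g2 \<in> ?E 0"
    using f(1) g(1) by (blast intro: gps_exponents_in_add)+
  from gps_exponents_in_level_mult[OF this(1) g(3)] gps_exponents_in_level_mult[OF f(3) this(2)]
    gps_exponents_in_level_mult[OF f(2) g(2)]
  have "(f0 + f1) * g2 + f2 * (g0 + g1 + g2) + f1 * g1 \<in> ?E 2"
    by (intro gps_exponents_in_add) (simp_all only: add_0_right add_0_left one_add_one)
  moreover have "f * g - (f0 * g0 + (f0 * g1 + f1 * g0)) = (f0 + f1) * g2 + f2 * (g0 + g1 + g2) + f1 * g1"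
    unfolding f2_def g2_def by (simp add: algebra_simps)
  moreover have "f0 * g0 \<in> ?E 0" "f0 * g1 \<in> ?E 1" "f1 * g0 \<in> ?E 1"
    using gps_exponents_in_level_mult[OF f(1) g(1)] gps_exponents_in_level_mult[OF f(1) g(2)]
      gps_exponents_in_level_mult[OF f(2) g(1)] by (simp_all only: add_0_right add_0_left)
  ultimately show ?thesis unfolding first_order_def by (simp only: gps_exponents_in_add)
qed

lemma first_order_one: "first_order P T 1 1 0"
  by (simp add: first_order_def gps_exponents_in_zero gps_exponents_in_hull_one)

lemma first_order_power:
  assumes "first_order P T f f0 f1"
  shows "first_order P T (f ^ k) (f0 ^ k) (of_nat k * f0 ^ (k - 1) * f1)"
proof (induction k)
  case (Suc k)
  have "f0 * (of_nat k * f0 ^ (k - 1) * f1) + f1 * f0 ^ k = of_nat (Suc k) * f0 ^ k * f1"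
    by (cases k) (simp_all add: algebra_simps)
  with first_order_mult[OF assms Suc] show ?case by simp
qed (simp add: first_order_one)

lemma first_order_monomial:
  fixes N :: nat
  assumes "\<And>i. i < N \<Longrightarrow> G i \<in> gps_exponents_in (sum_level P T 0)"
    "\<And>i. i < N \<Longrightarrow> H i \<in> gps_exponents_in (sum_level P T 1)"
  shows "first_order P T (\<Prod>i<N. (G i + H i) ^ \<alpha> i) (\<Prod>i<N. G i ^ \<alpha> i)
    (\<Sum>i<N. of_nat (\<alpha> i) * (\<Prod>j<N. G j ^ (\<alpha>(i := \<alpha> i - 1)) j) * H i)"
  using assms
proof (induction N)
  case (Suc N)
  have "first_order P T (G N + H N) (G N) (H N)"
    using Suc.prems by (simp add: first_order_def gps_exponents_in_zero)
  then have power: "first_order P T ((G N + H N) ^ \<alpha> N) (G N ^ \<alpha> N) (of_nat (\<alpha> N) * G N ^ (\<alpha> N - 1) * H N)"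
    by (rule first_order_power)
  have IH: "first_order P T (\<Prod>i<N. (G i + H i) ^ \<alpha> i) (\<Prod>i<N. G i ^ \<alpha> i)
    (\<Sum>i<N. of_nat (\<alpha> i) * (\<Prod>j<N. G j ^ (\<alpha>(i := \<alpha> i - 1)) j) * H i)"
    by (rule Suc.IH; rule Suc.prems; simp)
  have eq: "(\<Prod>i<N. G i ^ \<alpha> i) * (of_nat (\<alpha> N) * G N ^ (\<alpha> N - 1) * H N) +
      (\<Sum>i<N. of_nat (\<alpha> i) * (\<Prod>j<N. G j ^ (\<alpha>(i := \<alpha> i - 1)) j) * H i) * G N ^ \<alpha> N
    = (\<Sum>i<Suc N. of_nat (\<alpha> i) * (\<Prod>j<Suc N. G j ^ (\<alpha>(i := \<alpha> i - 1)) j) * H i)"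
  proof -
    have "(\<Sum>i<N. of_nat (\<alpha> i) * (\<Prod>j<N. G j ^ (\<alpha>(i := \<alpha> i - 1)) j) * H i) * G N ^ \<alpha> N
      = (\<Sum>i<N. of_nat (\<alpha> i) * (\<Prod>j<Suc N. G j ^ (\<alpha>(i := \<alpha> i - 1)) j) * H i)"
      unfolding sum_distrib_right by (rule sum.cong) (simp_all add: ac_simps)
    moreover have "(\<Prod>j<Suc N. G j ^ (\<alpha>(N := \<alpha> N - 1)) j) = (\<Prod>i<N. G i ^ \<alpha> i) * G N ^ (\<alpha> N - 1)"
      by simp
    ultimately show ?thesis by (simp add: ac_simps)
  qed
  from first_order_mult[OF IH power] show ?case
    unfolding eq by (simp only: prod.lessThan_Suc)
qed (simp add: first_order_one)

lemma gps_coeff_subst_superset: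
  assumes "\<And>i. i < N \<Longrightarrow> gps_coeff (G i) 0 = 0" "finite B" "B \<subseteq> multi_indices N"
    "\<And>\<alpha>. \<alpha> \<in> multi_indices N \<Longrightarrow> gps_coeff (\<Prod>i<N. G i ^ \<alpha> i) a \<noteq> 0 \<Longrightarrow> \<alpha> \<in> B"
  shows "gps_coeff (gps_subst N F G) a = (\<Sum>\<alpha>\<in>B. taylor_coeff N F \<alpha> * gps_coeff (\<Prod>i<N. G i ^ \<alpha> i) a)"
proof -
  have "gps_coeff (gps_subst N F G) a =
      (\<Sum>\<alpha> | \<alpha> \<in> multi_indices N \<and> gps_coeff (\<Prod>i<N. G i ^ \<alpha> i) a \<noteq> 0.
        taylor_coeff N F \<alpha> * gps_coeff (\<Prod>i<N. G i ^ \<alpha> i) a)"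
    by (rule gps_coeff_subst) (rule assms(1))
  also have "\<dots> = (\<Sum>\<alpha>\<in>B. taylor_coeff N F \<alpha> * gps_coeff (\<Prod>i<N. G i ^ \<alpha> i) a)"
    by (rule sum.mono_neutral_left) (use assms in auto)
  finally show ?thesis .
qed

text \<open>At a given exponent only finitely many monomials matter, so the claim follows from
  \<open>first_order_monomial\<close>; the linear terms of the monomials are regrouped into the series of the
  partial derivatives.\<close>

lemma gps_subst_first_order:
  assumes F: "holomorphic_near_0 N F"
    and G: "\<And>i. i < N \<Longrightarrow> gps_coeff (G i) 0 = 0" "\<And>i. i < N \<Longrightarrow> G i \<in> gps_exponents_in (sum_level P T 0)"
    and H: "\<And>i. i < N \<Longrightarrow> gps_coeff (H i) 0 = 0" "\<And>i. i < N \<Longrightarrow> H i \<in> gps_exponents_in (sum_level P T 1)"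
    and e: "e \<notin> sum_level P T 2"
  shows "gps_coeff (gps_subst N F (\<lambda>i. G i + H i)) e
    = gps_coeff (gps_subst N F G) e + (\<Sum>i<N. gps_coeff (gps_subst N (partial_deriv i F) G * H i) e)"
proof -
  define mon where "mon K \<alpha> = (\<Prod>i<N. K i ^ \<alpha> i :: gps)" for K and \<alpha> :: "nat \<Rightarrow> nat"
  define R where "R K = {\<alpha> \<in> multi_indices N. \<exists>a. gps_coeff (mon K \<alpha>) a \<noteq> 0 \<and> Re a \<le> Re e}" for K
  have GH: "gps_coeff (G i + H i) 0 = 0" if "i < N" for i
    using that G(1) H(1) by (simp add: gps_coeff_add)
  have finR: "finite (R G)" "finite (R (\<lambda>i. G i + H i))"
    unfolding R_def mon_def by (rule gps_subst_finite_below, use G(1) GH in blast)+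
  \<comment> \<open>\<open>up i\<close> and \<open>down i\<close> add and subtract the \<open>i\<close>-th unit vector.\<close>
  define up where "up i \<alpha> = \<alpha>(i := Suc (\<alpha> i))" for i and \<alpha> :: "nat \<Rightarrow> nat"
  define down where "down i \<alpha> = \<alpha>(i := \<alpha> i - 1)" for i and \<alpha> :: "nat \<Rightarrow> nat"
  have up_down: "down i (up i \<alpha>) = \<alpha>" "\<alpha> i \<noteq> 0 \<Longrightarrow> up i (down i \<alpha>) = \<alpha>" for i \<alpha>
    by (auto simp: up_def down_def)
  have up_multi: "up i \<alpha> \<in> multi_indices N" "down i \<alpha> \<in> multi_indices N"
    if "i < N" "\<alpha> \<in> multi_indices N" for i \<alpha>
    using that by (auto simp: up_def down_def multi_indices_def)
  \<comment> \<open>\<open>B\<close> contains all multi-indices that matter for the coefficient at \<open>e\<close> in any of the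
    series involved.\<close>
  define B where "B = R G \<union> R (\<lambda>i. G i + H i) \<union> (\<Union>i<N. up i ` R G)"
  have B: "finite B" "B \<subseteq> multi_indices N"
    using finR up_multi by (auto simp: B_def R_def)
  have linear: "gps_coeff (gps_subst N (partial_deriv i F) G * H i) e
      = (\<Sum>\<alpha>\<in>B. taylor_coeff N F \<alpha> * gps_coeff (of_nat (\<alpha> i) * mon G (down i \<alpha>) * H i) e)"
    if i: "i < N" for i
  proof -
    define D where "D = {b. gps_coeff (H i) b \<noteq> 0 \<and> Re b \<le> Re e}"
    define B' where "B' = {\<beta> \<in> multi_indices N. up i \<beta> \<in> B}"
    have finD: "finite D" unfolding D_def by (rule gps_finite_support)
    have "B' \<subseteq> down i ` B"
    proof
      fix \<beta> assume "\<beta> \<in> B'"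
      then show "\<beta> \<in> down i ` B"
        using up_down(1)[of i \<beta>] by (intro image_eqI[of _ _ "up i \<beta>"]) (auto simp: B'_def)
    qed
    then have finB': "finite B'" using B(1) finite_surj by blast
    have "gps_coeff (gps_subst N (partial_deriv i F) G * H i) e
        = gps_coeff (H i * gps_subst N (partial_deriv i F) G) e" by (simp add: mult.commute)
    also have "\<dots> = (\<Sum>b\<in>D. gps_coeff (H i) b * gps_coeff (gps_subst N (partial_deriv i F) G) (e - b))"
      by (rule gps_coeff_mult_superset[OF finD]) (simp add: D_def)
    also have "\<dots> = (\<Sum>b\<in>D. gps_coeff (H i) b *
        (\<Sum>\<beta>\<in>B'. taylor_coeff N (partial_deriv i F) \<beta> * gps_coeff (mon G \<beta>) (e - b)))"
    proof (rule sum.cong[OF refl])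
      fix b assume "b \<in> D"
      then have "Re b \<ge> 0" by (auto simp: D_def dest: gps_coeff_nonzero_Re)
      have "gps_coeff (gps_subst N (partial_deriv i F) G) (e - b)
          = (\<Sum>\<beta>\<in>B'. taylor_coeff N (partial_deriv i F) \<beta> * gps_coeff (mon G \<beta>) (e - b))"
        unfolding mon_def
      proof (rule gps_coeff_subst_superset[OF G(1) finB'])
        fix \<alpha> assume "\<alpha> \<in> multi_indices N" "gps_coeff (\<Prod>i<N. G i ^ \<alpha> i) (e - b) \<noteq> 0"
        then have "\<alpha> \<in> R G"
          using \<open>Re b \<ge> 0\<close> unfolding R_def mon_def by (intro CollectI conjI exI[of _ "e - b"]) auto
        then show "\<alpha> \<in> B'" using i by (auto simp: B'_def B_def R_def)
      qed (auto simp: B'_def)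
      then show "gps_coeff (H i) b * gps_coeff (gps_subst N (partial_deriv i F) G) (e - b) =
          gps_coeff (H i) b * (\<Sum>\<beta>\<in>B'. taylor_coeff N (partial_deriv i F) \<beta> * gps_coeff (mon G \<beta>) (e - b))"
        by simp
    qed
    also have "\<dots> = (\<Sum>\<beta>\<in>B'. taylor_coeff N (partial_deriv i F) \<beta> *
        (\<Sum>b\<in>D. gps_coeff (H i) b * gps_coeff (mon G \<beta>) (e - b)))"
      by (simp add: sum_distrib_left mult.left_commute) (rule sum.swap)
    also have "\<dots> = (\<Sum>\<beta>\<in>B'. taylor_coeff N (partial_deriv i F) \<beta> * gps_coeff (H i * mon G \<beta>) e)"
      by (intro sum.cong refl arg_cong2[of _ _ _ _ "(*)"] gps_coeff_mult_superset[symmetric] finD)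
        (simp add: D_def)
    also have "\<dots> = (\<Sum>\<beta>\<in>B'. taylor_coeff N F (up i \<beta>) *
        gps_coeff (of_nat (up i \<beta> i) * mon G (down i (up i \<beta>)) * H i) e)"
    proof (rule sum.cong[OF refl])
      fix \<beta>
      have "gps_coeff (of_nat (up i \<beta> i) * mon G (down i (up i \<beta>)) * H i) e
          = of_nat (Suc (\<beta> i)) * gps_coeff (H i * mon G \<beta>) e"
        unfolding up_down(1) mult.assoc gps_coeff_of_nat_mult by (simp add: up_def mult.commute)
      then show "taylor_coeff N (partial_deriv i F) \<beta> * gps_coeff (H i * mon G \<beta>) e =
          taylor_coeff N F (up i \<beta>) * gps_coeff (of_nat (up i \<beta> i) * mon G (down i (up i \<beta>)) * H i) e"
        by (simp add: taylor_coeff_partial_deriv[OF F i, folded up_def] del: of_nat_Suc)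
    qed
    also have "\<dots> = (\<Sum>\<alpha>\<in>{\<alpha> \<in> B. \<alpha> i \<noteq> 0}. taylor_coeff N F \<alpha> * gps_coeff (of_nat (\<alpha> i) * mon G (down i \<alpha>) * H i) e)"
    proof (rule sum.reindex_bij_witness[of _ "down i" "up i"])
      show "up i \<beta> \<in> {\<alpha> \<in> B. \<alpha> i \<noteq> 0}" if "\<beta> \<in> B'" for \<beta>
        using that by (simp add: B'_def) (simp add: up_def)
      show "down i \<alpha> \<in> B'" if "\<alpha> \<in> {\<alpha> \<in> B. \<alpha> i \<noteq> 0}" for \<alpha>
        using that B(2) up_multi(2)[OF i] up_down(2)[of \<alpha> i] by (auto simp: B'_def)
      show "up i (down i \<alpha>) = \<alpha>" if "\<alpha> \<in> {\<alpha> \<in> B. \<alpha> i \<noteq> 0}" for \<alpha>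
        using that up_down(2) by blast
    qed (rule up_down(1), rule refl)
    also have "\<dots> = (\<Sum>\<alpha>\<in>B. taylor_coeff N F \<alpha> * gps_coeff (of_nat (\<alpha> i) * mon G (down i \<alpha>) * H i) e)"
      by (rule sum.mono_neutral_left[OF B(1)]) (auto simp: gps_coeff_zero)
    finally show ?thesis .
  qed
  have "gps_coeff (gps_subst N F (\<lambda>i. G i + H i)) e
      = (\<Sum>\<alpha>\<in>B. taylor_coeff N F \<alpha> * gps_coeff (mon (\<lambda>i. G i + H i) \<alpha>) e)"
    unfolding mon_def by (rule gps_coeff_subst_superset[OF GH B]) (auto simp: B_def R_def mon_def)
  also have "\<dots> = (\<Sum>\<alpha>\<in>B. taylor_coeff N F \<alpha> * (gps_coeff (mon G \<alpha>) e +
      (\<Sum>i<N. gps_coeff (of_nat (\<alpha> i) * mon G (down i \<alpha>) * H i) e)))"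
  proof (intro sum.cong refl arg_cong2[of _ _ _ _ "(*)"])
    fix \<alpha>
    have "first_order P T (mon (\<lambda>i. G i + H i) \<alpha>) (mon G \<alpha>)
        (\<Sum>i<N. of_nat (\<alpha> i) * mon G (down i \<alpha>) * H i)"
      unfolding mon_def down_def using G(2) H(2) by (rule first_order_monomial)
    then have "gps_coeff (mon (\<lambda>i. G i + H i) \<alpha> -
        (mon G \<alpha> + (\<Sum>i<N. of_nat (\<alpha> i) * mon G (down i \<alpha>) * H i))) e = 0"
      using e by (auto simp: first_order_def gps_exponents_in_def)
    then show "gps_coeff (mon (\<lambda>i. G i + H i) \<alpha>) e = gps_coeff (mon G \<alpha>) e +
        (\<Sum>i<N. gps_coeff (of_nat (\<alpha> i) * mon G (down i \<alpha>) * H i) e)"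
      by (simp add: gps_coeff_diff gps_coeff_add gps_coeff_sum)
  qed
  also have "\<dots> = (\<Sum>\<alpha>\<in>B. taylor_coeff N F \<alpha> * gps_coeff (mon G \<alpha>) e) +
      (\<Sum>i<N. \<Sum>\<alpha>\<in>B. taylor_coeff N F \<alpha> * gps_coeff (of_nat (\<alpha> i) * mon G (down i \<alpha>) * H i) e)"
    by (simp add: distrib_left sum.distrib sum_distrib_left) (rule sum.swap)
  also have "(\<Sum>\<alpha>\<in>B. taylor_coeff N F \<alpha> * gps_coeff (mon G \<alpha>) e) = gps_coeff (gps_subst N F G) e"
    unfolding mon_def
    by (rule gps_coeff_subst_superset[OF G(1) B, symmetric]) (auto simp: B_def R_def mon_def)
  also have "(\<Sum>i<N. \<Sum>\<alpha>\<in>B. taylor_coeff N F \<alpha> * gps_coeff (of_nat (\<alpha> i) * mon G (down i \<alpha>) * H i) e)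
      = (\<Sum>i<N. gps_coeff (gps_subst N (partial_deriv i F) G * H i) e)"
    by (simp add: linear)
  finally show ?thesis .
qed

section \<open>The recursion for the exponents of a formal solution\<close>

text \<open>The part of a series formed by the terms whose exponents satisfy a given condition.\<close>

lift_definition gps_filter :: "(complex \<Rightarrow> bool) \<Rightarrow> gps \<Rightarrow> gps" is "\<lambda>Q f a. if Q a then f a else 0"
proof (intro conjI allI impI, goal_cases)
  case (2 Q f r)
  then have "finite {a. f a \<noteq> 0 \<and> Re a \<le> r}" by blast
  then show ?case by (rule finite_subset[rotated]) (auto split: if_splits)
qed (auto split: if_splits)

lemma gps_coeff_filter: "gps_coeff (gps_filter Q f) a = (if Q a then gps_coeff f a else 0)"
  by (simp add: gps_filter.rep_eq)

lemma gps_coeff_delta_funpow: "gps_coeff ((gps_delta ^^ j) f) a = a ^ j * gps_coeff f a"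
  by (induction j) (simp_all add: gps_delta.rep_eq)

lemma gps_coeff_sigma_funpow: "gps_coeff ((gps_sigma u ^^ j) f) a = exp (a * u) ^ j * gps_coeff f a"
  by (induction j) (simp_all add: gps_sigma.rep_eq)

lemma gps_coeff_mu_funpow:
  "l > 0 \<Longrightarrow> gps_coeff ((gps_mu l ^^ j) f) a = gps_coeff f (a / of_nat (l ^ j))"
  by (induction j arbitrary: a) (simp_all add: gps_mu.rep_eq field_simps)

lemma eval_along_exponents_in:
  assumes "\<And>j. gps_coeff ((\<Delta> ^^ j) f) 0 = 0" "\<And>j. (\<Delta> ^^ j) f \<in> gps_exponents_in (add_hull Q)"
    and "1 \<in> add_hull Q"
  shows "eval_along n F \<Delta> f \<in> gps_exponents_in (add_hull Q)"
  unfolding eval_along_def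
proof (rule gps_subst_exponents_in)
  fix i
  show "gps_coeff (gps_args \<Delta> f i) 0 = 0"
    using assms(1) by (cases i) (auto simp: gps_args_def gps_X.rep_eq)
  show "gps_args \<Delta> f i \<in> gps_exponents_in (add_hull Q)"
  proof (cases i)
    case 0
    then show ?thesis using assms(3) by (simp add: gps_args_def gps_exponents_in_def gps_X.rep_eq)
  qed (use assms(2) in \<open>simp add: gps_args_def\<close>)
qed

text \<open>The expansion is made at the solution \<open>f\<close> itself, with increment \<open>- g\<close>: then the
  coefficients of the linear part are the given partial derivatives along \<open>f\<close>, the constant
  term vanishes, and the value of \<open>F\<close> along \<open>f - g\<close> only involves exponents from the
  semigroup generated by \<open>P\<close>.\<close>

lemma linear_part_vanishes:
  assumes F: "holomorphic_near_0 (n + 2) F" and sol: "formal_solution n F \<Delta> f"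
    and diff: "\<And>j. (\<Delta> ^^ j) (f - g) = (\<Delta> ^^ j) f - (\<Delta> ^^ j) g"
    and const: "\<And>j. gps_coeff ((\<Delta> ^^ j) f) 0 = 0" "\<And>j. gps_coeff ((\<Delta> ^^ j) g) 0 = 0"
    and one: "1 \<in> add_hull P"
    and low: "\<And>j. (\<Delta> ^^ j) (f - g) \<in> gps_exponents_in (add_hull P)"
    and all: "\<And>j. (\<Delta> ^^ j) f \<in> gps_exponents_in (add_hull (P \<union> T))"
    and high: "\<And>j. j \<le> n \<Longrightarrow> (\<Delta> ^^ j) g \<in> gps_exponents_in (sum_level P T 1)"
    and e: "e \<notin> add_hull P" "e \<notin> sum_level P T 2"
  shows "(\<Sum>j\<le>n. gps_coeff (eval_along n (partial_deriv (Suc j) F) \<Delta> f * (\<Delta> ^^ j) g) e) = 0"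
proof -
  define H where "H i = (case i of 0 \<Rightarrow> 0 | Suc j \<Rightarrow> - (\<Delta> ^^ j) g)" for i
  have one': "1 \<in> add_hull (P \<union> T)" using one add_hull_mono[of P "P \<union> T"] by blast
  have sum_args: "(\<lambda>i. gps_args \<Delta> f i + H i) = gps_args \<Delta> (f - g)"
  proof
    fix i
    show "gps_args \<Delta> f i + H i = gps_args \<Delta> (f - g) i"
      by (cases i) (simp_all add: gps_args_def H_def diff)
  qed
  have "gps_coeff (gps_subst (n + 2) F (\<lambda>i. gps_args \<Delta> f i + H i)) e
    = gps_coeff (gps_subst (n + 2) F (gps_args \<Delta> f)) e +
      (\<Sum>i<n + 2. gps_coeff (gps_subst (n + 2) (partial_deriv i F) (gps_args \<Delta> f) * H i) e)"
  proof (rule gps_subst_first_order[OF F _ _ _ _ e(2)])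
    fix i assume i: "i < n + 2"
    show "gps_coeff (gps_args \<Delta> f i) 0 = 0"
      using const(1) by (cases i) (auto simp: gps_args_def gps_X.rep_eq)
    show "gps_args \<Delta> f i \<in> gps_exponents_in (sum_level P T 0)"
    proof (cases i)
      case 0
      then show ?thesis using one' by (simp add: gps_args_def gps_exponents_in_def gps_X.rep_eq)
    qed (use all in \<open>simp add: gps_args_def\<close>)
    show "gps_coeff (H i) 0 = 0"
      using const(2) by (cases i) (auto simp: H_def gps_coeff_zero gps_coeff_uminus)
    show "H i \<in> gps_exponents_in (sum_level P T 1)"
    proof (cases i)
      case 0
      then show ?thesis by (simp add: H_def gps_exponents_in_zero)
    next
      case (Suc j)
      with i gps_exponents_in_uminus[OF high[of j]] show ?thesis by (simp add: H_def)
    qed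
  qed
  moreover have "gps_coeff (gps_subst (n + 2) F (gps_args \<Delta> f)) e = 0"
    using sol by (simp add: formal_solution_def eval_along_def gps_coeff_zero)
  moreover have "gps_coeff (gps_subst (n + 2) F (gps_args \<Delta> (f - g))) e = 0"
  proof -
    have "eval_along n F \<Delta> (f - g) \<in> gps_exponents_in (add_hull P)"
      by (rule eval_along_exponents_in[OF _ low one]) (simp add: diff gps_coeff_diff const)
    then show ?thesis using e(1) by (auto simp: eval_along_def gps_exponents_in_def)
  qed
  ultimately have "(\<Sum>i<Suc (Suc n). gps_coeff (gps_subst (n + 2) (partial_deriv i F) (gps_args \<Delta> f) * H i) e) = 0"
    by (simp add: sum_args)
  moreover have "(\<Sum>i<Suc (Suc n). h i) = h 0 + (\<Sum>j\<le>n. h (Suc j))" for h :: "nat \<Rightarrow> complex"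
    by (subst sum.lessThan_Suc_shift) (simp only: lessThan_Suc_atMost)
  ultimately show ?thesis
    by (simp only:) (simp add: H_def gps_coeff_zero gps_coeff_uminus eval_along_def sum_negf)
qed

lemma gps_leading_coeff: "gps_leading H A \<nu> \<Longrightarrow> gps_coeff H \<nu> = A"
  by (auto simp: gps_leading_def gps_small_o_def)

lemma gps_leading_Re:
  assumes "gps_leading H A \<nu>" "gps_coeff H a \<noteq> 0" "a \<noteq> \<nu>"
  shows "Re a > Re \<nu>"
proof -
  from assms(1) obtain R where "gps_small_o \<nu> R" "gps_coeff H a = (if a = \<nu> then A else 0) + gps_coeff R a"
    unfolding gps_leading_def by blast
  with assms(2,3) show ?thesis by (simp add: gps_small_o_def)
qed

text \<open>A sum with a summand from \<open>T\<close> has real part greater than \<open>Re \<nu>\<close>.\<close>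

lemma leading_exponent_in_hull:
  assumes "gps_leading H A \<nu>" "A \<noteq> 0" "H \<in> gps_exponents_in (add_hull (P \<union> T))"
    and "\<And>p. p \<in> P \<Longrightarrow> Re p > 0" "\<And>t. t \<in> T \<Longrightarrow> Re t > Re \<nu>"
  shows "\<nu> \<in> add_hull P"
proof -
  have nz: "gps_coeff H \<nu> \<noteq> 0" using assms(1,2) by (simp add: gps_leading_coeff)
  then have "Re \<nu> \<ge> 0" by (rule gps_coeff_nonzero_Re)
  have "\<nu> \<in> add_hull (P \<union> T)" using nz assms(3) by (auto simp: gps_exponents_in_def)
  moreover have "\<nu> \<notin> sum_level P T (Suc 0)"
  proof
    assume "\<nu> \<in> sum_level P T (Suc 0)"
    then obtain t m where "t \<in> T" "m \<in> add_hull (P \<union> T)" "\<nu> = t + m" by auto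
    moreover have "Re p \<ge> 0" if "p \<in> P \<union> T" for p
      using that assms(4)[of p] assms(5)[of p] \<open>Re \<nu> \<ge> 0\<close> by auto
    ultimately have "Re m \<ge> 0" using add_hull_Re_nonneg by blast
    with \<open>t \<in> T\<close> \<open>\<nu> = t + m\<close> show False using assms(5)[of t] by simp
  qed
  ultimately show ?thesis using add_hull_Un_cases by blast
qed

text \<open>Products of other terms could only meet at the exponent \<open>\<kappa> + \<nu>\<close> if it had one of the two
  excluded representations.\<close>

lemma leading_term_coeff:
  assumes lead: "gps_leading H A \<nu>" and H: "H \<in> gps_exponents_in (add_hull (P \<union> T))"
    and g: "g \<in> gps_exponents_in T"
    and e1: "\<not> (\<exists>s\<in>add_hull P. \<exists>t\<in>T. Re s > Re \<nu> \<and> \<kappa> + \<nu> = s + t)"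
    and e2: "\<kappa> + \<nu> \<notin> sum_level P T 2"
  shows "gps_coeff (H * g) (\<kappa> + \<nu>) = A * gps_coeff g \<kappa>"
proof -
  define B where "B = insert \<nu> {b. gps_coeff H b \<noteq> 0 \<and> Re b \<le> Re (\<kappa> + \<nu>)}"
  have B: "finite B" unfolding B_def by (simp add: gps_finite_support del: plus_complex.sel)
  have "gps_coeff (H * g) (\<kappa> + \<nu>) = (\<Sum>b\<in>B. gps_coeff H b * gps_coeff g (\<kappa> + \<nu> - b))"
    by (rule gps_coeff_mult_superset[OF B]) (auto simp: B_def)
  also have "\<dots> = (\<Sum>b\<in>{\<nu>}. gps_coeff H b * gps_coeff g (\<kappa> + \<nu> - b))"
  proof (rule sum.mono_neutral_right[OF B])
    show "\<forall>b\<in>B - {\<nu>}. gps_coeff H b * gps_coeff g (\<kappa> + \<nu> - b) = 0"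
    proof (rule ballI, rule ccontr)
      fix b assume "b \<in> B - {\<nu>}" "gps_coeff H b * gps_coeff g (\<kappa> + \<nu> - b) \<noteq> 0"
      then have b: "b \<noteq> \<nu>" "gps_coeff H b \<noteq> 0" "gps_coeff g (\<kappa> + \<nu> - b) \<noteq> 0" by auto
      have "Re b > Re \<nu>" using gps_leading_Re[OF lead b(2,1)] .
      have t: "\<kappa> + \<nu> - b \<in> T" using b(3) g by (simp add: gps_exponents_in_def)
      have eq: "\<kappa> + \<nu> = b + (\<kappa> + \<nu> - b)" by simp
      from b(2) H have "b \<in> add_hull (P \<union> T)" by (simp add: gps_exponents_in_def)
      then consider "b \<in> add_hull P" | "b \<in> sum_level P T (Suc 0)" using add_hull_Un_cases by blast
      then show False
      proof cases
        case 1
        with e1 \<open>Re b > Re \<nu>\<close> t eq show False by blast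
      next
        case 2
        from sum_level_add[OF this sum_level_1[OF t]] have "b + (\<kappa> + \<nu> - b) \<in> sum_level P T 2"
          by (simp only: add_Suc add_0 numeral_2_eq_2)
        with e2 eq show False by simp
      qed
    qed
  qed (simp add: B_def)
  also have "\<dots> = A * gps_coeff g \<kappa>" using gps_leading_coeff[OF lead] by simp
  finally show ?thesis .
qed

text \<open>The operator is described by its action on exponents.  For \<open>j \<in> J\<close> its power \<open>\<Delta> ^^ j\<close>
  multiplies each term \<open>x\<^sup>a\<close> by a number \<open>m j a\<close>; the other powers produce only sums
  with at least two of the given exponents as summands, so that their contribution to the linear part is of higher
  order.  At the exponents \<open>\<kappa>\<close> with \<open>(\<Sum>j\<in>J. A j * m j \<kappa>) = 0\<close> the linear part loses its
  leading term; these are exceptional.\<close>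

lemma pos_fin_gen_solution:
  assumes F: "holomorphic_near_0 (n + 2) F" and sol: "formal_solution n F \<Delta> f"
    and const: "gps_coeff f 0 = 0"
    and lin: "\<And>j g h. (\<Delta> ^^ j) (g - h) = (\<Delta> ^^ j) g - (\<Delta> ^^ j) h"
    and op_const: "\<And>j g. gps_coeff g 0 = 0 \<Longrightarrow> gps_coeff ((\<Delta> ^^ j) g) 0 = 0"
    and op_hull: "\<And>j g Q. g \<in> gps_exponents_in (add_hull Q) \<Longrightarrow> (\<Delta> ^^ j) g \<in> gps_exponents_in (add_hull Q)"
    and J: "J \<subseteq> {..n}"
    and diag: "\<And>j g a. j \<in> J \<Longrightarrow> gps_coeff ((\<Delta> ^^ j) g) a = m j a * gps_coeff g a"
    and dilate: "\<And>j g P T. j \<le> n \<Longrightarrow> j \<notin> J \<Longrightarrow> g \<in> gps_exponents_in T \<Longrightarrow>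
      (\<Delta> ^^ j) g \<in> gps_exponents_in (sum_level P T 2)"
    and lead: "\<And>j. j \<in> J \<Longrightarrow> gps_leading (eval_along n (partial_deriv (Suc j) F) \<Delta> f) (A j) \<nu>"
    and A: "\<exists>j\<in>J. A j \<noteq> 0"
    and X: "pos_fin_gen {x - \<nu> | x. gps_coeff f x \<noteq> 0 \<and> Re x > Re \<nu> \<and> (\<Sum>j\<in>J. A j * m j x) = 0}"
  shows "pos_fin_gen {a. gps_coeff f a \<noteq> 0}"
proof -
  define P where "P = insert 1 {a. gps_coeff f a \<noteq> 0 \<and> Re a \<le> Re \<nu>}"
  define T where "T = {a. gps_coeff f a \<noteq> 0 \<and> Re a > Re \<nu>}"
  define g where "g = gps_filter (\<lambda>a. Re a > Re \<nu>) f"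
  have finP: "finite P" unfolding P_def by (simp add: gps_finite_support)
  have posP: "Re p > 0" if "p \<in> P" for p
    using that const gps_coeff_nonzero_cases[of f p] by (auto simp: P_def)
  have one: "1 \<in> add_hull P" "1 \<in> add_hull (P \<union> T)" by (rule add_hull_gen, simp add: P_def)+
  have "f \<in> gps_exponents_in (add_hull (P \<union> T))" "f - g \<in> gps_exponents_in (add_hull P)"
    and g_in: "g \<in> gps_exponents_in T"
    by (auto simp: gps_exponents_in_def g_def gps_coeff_diff gps_coeff_filter P_def T_def not_less
        intro!: add_hull_gen split: if_splits)
  then have f_exp: "(\<Delta> ^^ j) f \<in> gps_exponents_in (add_hull (P \<union> T))"
    and f0_exp: "(\<Delta> ^^ j) (f - g) \<in> gps_exponents_in (add_hull P)" for j
    by (auto intro: op_hull)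
  have g_exp_J: "(\<Delta> ^^ j) g \<in> gps_exponents_in T" if "j \<in> J" for j
    using g_in by (auto simp: gps_exponents_in_def diag[OF that])
  have g_exp: "(\<Delta> ^^ j) g \<in> gps_exponents_in (sum_level P T 1)" if "j \<le> n" for j
  proof (cases "j \<in> J")
    case True
    show ?thesis using g_exp_J[OF True] by (rule gps_exponents_in_mono) (use sum_level_1 in auto)
  next
    case False
    show ?thesis by (rule gps_exponents_in_level_mono[OF dilate[OF that False g_in]]) simp
  qed
  have c0: "gps_coeff ((\<Delta> ^^ j) f) 0 = 0" "gps_coeff ((\<Delta> ^^ j) g) 0 = 0" for j
    by (simp_all add: op_const const g_def gps_coeff_filter)
  have H: "eval_along n (partial_deriv (Suc j) F) \<Delta> f \<in> gps_exponents_in (add_hull (P \<union> T))" for j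
    by (rule eval_along_exponents_in[OF c0(1) f_exp one(2)])
  let ?c = "\<lambda>\<kappa> j. gps_coeff (eval_along n (partial_deriv (Suc j) F) \<Delta> f * (\<Delta> ^^ j) g) (\<kappa> + \<nu>)"
  have "pos_fin_gen (P \<union> T)"
  proof (rule pos_fin_gen_recursive_exponents[OF finP posP, where \<nu> = \<nu>])
    from A obtain j where "j \<in> J" "A j \<noteq> 0" by blast
    with leading_exponent_in_hull[OF lead[of j] _ H posP] show "\<nu> \<in> add_hull P"
      by (simp add: T_def)
    show "finite {t \<in> T. Re t \<le> r}" for r
      by (rule finite_subset[OF _ gps_finite_support[of f r]]) (auto simp: T_def)
    show "pos_fin_gen {x - \<nu> | x. x \<in> {x \<in> T. (\<Sum>j\<in>J. A j * m j x) = 0}}"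
      by (rule pos_fin_gen_subset[OF X]) (auto simp: T_def)
    fix \<kappa> assume \<kappa>: "\<kappa> \<in> T"
    show "\<kappa> \<in> {x \<in> T. (\<Sum>j\<in>J. A j * m j x) = 0} \<or> \<kappa> + \<nu> \<in> add_hull P \<or>
      (\<exists>s\<in>add_hull P. \<exists>t\<in>T. Re s > Re \<nu> \<and> \<kappa> + \<nu> = s + t) \<or> \<kappa> + \<nu> \<in> sum_level P T 2"
    proof (rule ccontr)
      assume "\<not> ?thesis"
      then have e: "\<kappa> + \<nu> \<notin> add_hull P" "\<kappa> + \<nu> \<notin> sum_level P T 2"
        "\<not> (\<exists>s\<in>add_hull P. \<exists>t\<in>T. Re s > Re \<nu> \<and> \<kappa> + \<nu> = s + t)"
        "(\<Sum>j\<in>J. A j * m j \<kappa>) \<noteq> 0" using \<kappa> by auto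
      have other: "?c \<kappa> j = 0" if "j \<in> {..n} - J" for j
      proof -
        have "eval_along n (partial_deriv (Suc j) F) \<Delta> f * (\<Delta> ^^ j) g
            \<in> gps_exponents_in (sum_level P T (0 + 2))"
          using that H g_in by (intro gps_exponents_in_level_mult dilate) auto
        with e(2) show ?thesis unfolding add_0 gps_exponents_in_def by blast
      qed
      have "0 = (\<Sum>j\<le>n. ?c \<kappa> j)"
        by (rule linear_part_vanishes[OF F sol lin c0 one(1) f0_exp f_exp g_exp e(1,2), symmetric])
      also have "\<dots> = (\<Sum>j\<in>J. ?c \<kappa> j)"
        by (rule sum.mono_neutral_right) (use J other in auto)
      also have "\<dots> = (\<Sum>j\<in>J. A j * gps_coeff ((\<Delta> ^^ j) g) \<kappa>)"
        by (intro sum.cong refl leading_term_coeff[OF lead H g_exp_J e(3,2)])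
      also have "\<dots> = (\<Sum>j\<in>J. A j * m j \<kappa>) * gps_coeff f \<kappa>"
        using \<kappa> by (simp add: diag g_def gps_coeff_filter T_def sum_distrib_right mult.assoc)
      finally show False using e(4) \<kappa> by (simp add: T_def)
    qed
  qed (auto simp: T_def)
  then show ?thesis by (rule pos_fin_gen_subset) (auto simp: P_def T_def)
qed

lemma pos_fin_gen_solution_diagonal:
  assumes F: "holomorphic_near_0 (n + 2) F" and sol: "formal_solution n F \<Delta> f"
    and mult: "\<And>j g a. gps_coeff ((\<Delta> ^^ j) g) a = m a ^ j * gps_coeff g a"
    and const: "gps_coeff f 0 = 0"
    and lead: "\<And>j. j \<le> n \<Longrightarrow> gps_leading (eval_along n (partial_deriv (Suc j) F) \<Delta> f) (A j) \<nu>"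
    and A: "\<exists>j\<le>n. A j \<noteq> 0"
    and X: "pos_fin_gen {x - \<nu> | x. gps_coeff f x \<noteq> 0 \<and> Re x > Re \<nu> \<and> (\<Sum>j\<le>n. A j * m x ^ j) = 0}"
  shows "pos_fin_gen {a. gps_coeff f a \<noteq> 0}"
proof (rule pos_fin_gen_solution[OF F sol const, where J = "{..n}" and m = "\<lambda>j a. m a ^ j"])
  show "(\<Delta> ^^ j) (g - h) = (\<Delta> ^^ j) g - (\<Delta> ^^ j) h" for j g h
    by (rule gps_eqI) (simp add: mult gps_coeff_diff right_diff_distrib)
  show "(\<Delta> ^^ j) g \<in> gps_exponents_in (add_hull Q)" if "g \<in> gps_exponents_in (add_hull Q)" for j g Q
    using that by (simp add: gps_exponents_in_def mult)
  show "\<exists>j\<in>{..n}. A j \<noteq> 0" using A by auto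
qed (use mult lead X in auto)

lemma pos_fin_gen_solution_mu:
  assumes F: "holomorphic_near_0 (n + 2) F" and sol: "formal_solution n F (gps_mu l) f"
    and l: "l \<ge> 2" and const: "gps_coeff f 0 = 0"
    and lead: "gps_leading (eval_along n (partial_deriv (Suc 0) F) (gps_mu l) f) A \<nu>" and A: "A \<noteq> 0"
  shows "pos_fin_gen {a. gps_coeff f a \<noteq> 0}"
proof (rule pos_fin_gen_solution[OF F sol const, where J = "{0}" and m = "\<lambda>_ _. 1" and A = "\<lambda>_. A"])
  let ?\<Delta> = "gps_mu l"
  have mu: "gps_coeff ((?\<Delta> ^^ j) g) a = gps_coeff g (a / of_nat (l ^ j))" for j g a
    using l by (intro gps_coeff_mu_funpow) simp
  have scale: "(?\<Delta> ^^ j) g \<in> gps_exponents_in B"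
    if "g \<in> gps_exponents_in C" "\<And>a. a \<in> C \<Longrightarrow> of_nat (l ^ j) * a \<in> B" for g j B C
    unfolding gps_exponents_in_def mem_Collect_eq mu
  proof (intro allI impI)
    fix a assume "gps_coeff g (a / of_nat (l ^ j)) \<noteq> 0"
    then have "a / of_nat (l ^ j) \<in> C" using that(1) unfolding gps_exponents_in_def by blast
    from that(2)[OF this] show "a \<in> B" using l by (cases "l = 0") simp_all
  qed
  show "(?\<Delta> ^^ j) (g - h) = (?\<Delta> ^^ j) g - (?\<Delta> ^^ j) h" for j g h
    by (rule gps_eqI) (simp only: mu gps_coeff_diff)
  show "gps_coeff ((?\<Delta> ^^ j) g) 0 = 0" if "gps_coeff g 0 = 0" for j g
    using that by (simp add: mu)
  show "(?\<Delta> ^^ j) g \<in> gps_exponents_in (add_hull Q)" if "g \<in> gps_exponents_in (add_hull Q)" for j g Q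
    using scale[OF that] by (simp only: add_hull_of_nat_mult)
  show "(?\<Delta> ^^ j) g \<in> gps_exponents_in (sum_level P T 2)"
    if "j \<notin> {0}" "g \<in> gps_exponents_in T" for j g P T
  proof (rule scale[OF that(2)])
    fix t assume t: "t \<in> T"
    have "l ^ j \<ge> 2" using l that(1) self_le_power[of l j] by fastforce
    then have "of_nat (l ^ j) * t = t + (t + of_nat (l ^ j - 2) * t)" by (simp add: algebra_simps)
    moreover have "of_nat (l ^ j - 2) * t \<in> add_hull (P \<union> T)"
      using t by (intro add_hull_of_nat_mult add_hull_gen) simp
    ultimately show "of_nat (l ^ j) * t \<in> sum_level P T 2"
      using t unfolding numeral_2_eq_2 sum_level.simps by blast
  qed
  show "pos_fin_gen {x - \<nu> | x. gps_coeff f x \<noteq> 0 \<and> Re x > Re \<nu> \<and> (\<Sum>j\<in>{0::nat}. A * 1) = 0}"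
    using A by (intro pos_fin_gen_finite) auto
qed (use lead A in auto)

section \<open>Exceptional exponents of \<open>q\<close>-difference equations\<close>

text \<open>Solutions of \<open>exp (x u) = w\<close> differ by integer multiples of \<open>\<omega> = 2 \<pi> \<i> / u\<close>.  If only finitely many of those
  considered lie in each half-plane, then either \<open>\<omega>\<close> is imaginary and there are finitely many,
  or one of them has least real part and the others differ from it by positive multiples of
  \<open>\<omega>\<close> or of \<open>- \<omega>\<close>.\<close>

lemma pos_fin_gen_exp_fibre:
  assumes u: "u \<noteq> 0" and S: "\<And>x. x \<in> S \<Longrightarrow> Re x > Re \<nu>" "\<And>r. finite {x \<in> S. Re x \<le> r}"
    and w: "\<And>x. x \<in> S \<Longrightarrow> exp (x * u) = w"
  shows "pos_fin_gen {x - \<nu> | x. x \<in> S}"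
proof (cases "S = {}")
  case True
  then show ?thesis by (auto intro: pos_fin_gen_finite)
next
  case False
  then obtain y where y: "y \<in> S" by blast
  have "finite (Re ` {x \<in> S. Re x \<le> Re y})" "Re ` {x \<in> S. Re x \<le> Re y} \<noteq> {}" using S(2) y by auto
  from Min_in[OF this] Min_le[OF this(1)] obtain z where z: "z \<in> S" "Re z \<le> Re y"
    "\<And>x. x \<in> S \<Longrightarrow> Re x \<le> Re y \<Longrightarrow> Re z \<le> Re x" by fastforce
  have z_le: "Re z \<le> Re x" if "x \<in> S" for x using z(2) z(3)[OF that] by linarith
  define \<omega> where "\<omega> = 2 * of_real pi * \<i> / u"
  have diff: "\<exists>k::int. x = z + of_int k * \<omega>" if "x \<in> S" for x
  proof -
    have "exp (x * u) = exp (z * u)" using w[OF that] w[OF z(1)] by simp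
    then obtain k :: int where "x * u = z * u + of_int (2 * k) * of_real pi * \<i>"
      unfolding exp_eq by auto
    then have "x * u = (z + of_int k * \<omega>) * u" using u by (simp add: \<omega>_def field_simps)
    then show ?thesis using u by auto
  qed
  show ?thesis
  proof (cases "Re \<omega> = 0")
    case True
    have "S \<subseteq> {x \<in> S. Re x \<le> Re z}"
    proof
      fix x assume x: "x \<in> S"
      with diff True have "Re x = Re z" by fastforce
      with x show "x \<in> {x \<in> S. Re x \<le> Re z}" by simp
    qed
    then have "finite S" using S(2) by (rule finite_subset)
    then show ?thesis using S(1) by (intro pos_fin_gen_finite) auto
  next
    case False
    define \<rho> where "\<rho> = (if Re \<omega> > 0 then \<omega> else - \<omega>)"
    have \<rho>: "Re \<rho> > 0" using False by (simp add: \<rho>_def)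
    have "x - \<nu> \<in> add_hull {z - \<nu>, \<rho>}" if x: "x \<in> S" for x
    proof -
      from diff[OF x] obtain k where "x = z + of_int k * \<omega>" by blast
      then obtain k' :: int where k': "x = z + of_int k' * \<rho>"
        by (cases "Re \<omega> > 0") (auto simp: \<rho>_def dest: meta_spec[of _ "- k"])
      have "real_of_int k' * Re \<rho> \<ge> 0" using z_le[OF x] k' by simp
      then have "k' \<ge> 0" using \<rho> by (simp add: zero_le_mult_iff)
      then have "x - \<nu> = (z - \<nu>) + of_nat (nat k') * \<rho>" using k' by simp
      also have "\<dots> \<in> add_hull {z - \<nu>, \<rho>}"
        by (intro add_hull_add add_hull_of_nat_mult add_hull_gen) auto
      finally show ?thesis .
    qed
    then show ?thesis
      unfolding pos_fin_gen_def using \<rho> S(1)[OF z(1)] by (intro exI[of _ "{z - \<nu>, \<rho>}"]) auto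
  qed
qed

section \<open>Finite generation of the exponents of a formal solution\<close>

theorem theorem4:
  fixes n l :: nat
    and F :: "(nat \<Rightarrow> complex) \<Rightarrow> complex"
    and \<phi> :: gps
    and c lam :: "nat \<Rightarrow> complex"
    and q lnq :: complex
  assumes "n \<ge> 1"
    and "holomorphic_near_0 (n + 2) F"
    and "gps_expansion \<phi> c lam" and "Re (lam 0) > 0"
    and "q \<noteq> 0" and "q \<noteq> 1" and "exp lnq = q"
    and "l \<ge> 2"
    and "(\<exists>\<Delta>\<in>{gps_delta, gps_sigma lnq}.
            formal_solution n F \<Delta> \<phi> \<and>
            (\<exists>A \<nu>. (\<forall>j\<le>n. gps_leading (eval_along n (partial_deriv (Suc j) F) \<Delta> \<phi>) (A j) \<nu>) \<and>
                   (\<exists>j\<le>n. A j \<noteq> 0)))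
         \<or> (formal_solution n F (gps_mu l) \<phi> \<and>
            (\<exists>A\<^sub>0 \<nu>\<^sub>0. gps_leading (eval_along n (partial_deriv (Suc 0) F) (gps_mu l) \<phi>) A\<^sub>0 \<nu>\<^sub>0 \<and>
                     A\<^sub>0 \<noteq> 0))"
  shows "\<exists>P. finite P \<and> (\<forall>\<rho>\<in>P. Re \<rho> > 0) \<and> independent_over_int P \<and>
             \<phi> \<in> gps_exponents_in (semigroup_generated P)"
proof -
  have "Re (lam k) > 0" for k
    using assms(3,4) monoD[of "\<lambda>k. Re (lam k)" 0 k] by (simp add: gps_expansion_def)
  then have "0 \<notin> range lam" by (metis imageE less_irrefl zero_complex.sel(1))
  then have const: "gps_coeff \<phi> 0 = 0" using assms(3) by (simp add: gps_expansion_def)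
  have lnq: "lnq \<noteq> 0" using assms(6,7) by auto
  have "pos_fin_gen {a. gps_coeff \<phi> a \<noteq> 0}"
  proof -
    from assms(9) consider (linear) \<Delta> A \<nu> where "\<Delta> \<in> {gps_delta, gps_sigma lnq}"
        "formal_solution n F \<Delta> \<phi>" "\<exists>j\<le>n. A j \<noteq> 0"
        "\<forall>j\<le>n. gps_leading (eval_along n (partial_deriv (Suc j) F) \<Delta> \<phi>) (A j) \<nu>"
      | (mu) A \<nu> where "formal_solution n F (gps_mu l) \<phi>" "A \<noteq> 0"
        "gps_leading (eval_along n (partial_deriv (Suc 0) F) (gps_mu l) \<phi>) A \<nu>" by blast
    then show ?thesis
    proof cases
      case linear
      note \<Delta> = linear(1) and sol = linear(2) and A = linear(3) and lead = linear(4)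
      let ?S = "{x. gps_coeff \<phi> x \<noteq> 0 \<and> Re x > Re \<nu>}"
      have roots: "finite {z. (\<Sum>j\<le>n. A j * z ^ j) = 0}"
        using A by (simp add: polyfun_finite_roots)
      from \<Delta> consider "\<Delta> = gps_delta" | "\<Delta> = gps_sigma lnq" by blast
      then show ?thesis
      proof cases
        case 1
        have "pos_fin_gen {x - \<nu> | x. gps_coeff \<phi> x \<noteq> 0 \<and> Re x > Re \<nu> \<and> (\<Sum>j\<le>n. A j * x ^ j) = 0}"
        proof (rule pos_fin_gen_finite)
          show "finite {x - \<nu> | x. gps_coeff \<phi> x \<noteq> 0 \<and> Re x > Re \<nu> \<and> (\<Sum>j\<le>n. A j * x ^ j) = 0}"
            by (rule finite_subset[OF _ finite_imageI[OF roots, of "\<lambda>x. x - \<nu>"]]) auto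
        qed auto
        with assms(2) sol const lead A show ?thesis
          by (intro pos_fin_gen_solution_diagonal[of n F \<Delta> \<phi> "\<lambda>a. a" A \<nu>])
            (simp_all add: 1 gps_coeff_delta_funpow)
      next
        case 2
        have "pos_fin_gen (\<Union>w\<in>{z. (\<Sum>j\<le>n. A j * z ^ j) = 0}. {x - \<nu> | x. x \<in> {x \<in> ?S. exp (x * lnq) = w}})"
        proof (rule pos_fin_gen_UN[OF roots], rule pos_fin_gen_exp_fibre[OF lnq])
          show "finite {x \<in> {x \<in> ?S. exp (x * lnq) = w}. Re x \<le> r}" for w r
            by (rule finite_subset[OF _ gps_finite_support[of \<phi> r]]) auto
        qed auto
        then have "pos_fin_gen {x - \<nu> | x. gps_coeff \<phi> x \<noteq> 0 \<and> Re x > Re \<nu> \<and>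
            (\<Sum>j\<le>n. A j * exp (x * lnq) ^ j) = 0}"
          by (rule pos_fin_gen_subset) auto
        with assms(2) sol const lead A show ?thesis
          by (intro pos_fin_gen_solution_diagonal[of n F \<Delta> \<phi> "\<lambda>a. exp (a * lnq)" A \<nu>])
            (simp_all add: 2 gps_coeff_sigma_funpow)
      qed
    next
      case mu
      from pos_fin_gen_solution_mu[OF assms(2) mu(1) assms(8) const mu(3,2)] show ?thesis .
    qed
  qed
  then obtain P where "finite P" "\<forall>\<rho>\<in>P. Re \<rho> > 0" "independent_over_int P"
    "{a. gps_coeff \<phi> a \<noteq> 0} \<subseteq> semigroup_generated P"
    using pos_fin_gen_independent by blast
  then show ?thesis by (auto simp: gps_exponents_in_def)
qed

end
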